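(* Let $L$ be an uncountable compact line and let $K=L^\omega$ be endowed with the lexicographic order. Then there exist a compact line $\widetilde K$ and a continuous increasing surjection $\phi:\widetilde K\to K$ that has the $c_0$-extension property but does not have the $c_0(\omega_1)$-extension property.
   Context: A compact line is a totally ordered set which is compact in its order topology. For a set $I$, $c_0(I)$ is the Banach space (sup norm) of real families $(a_i)_{i\in I}$ with $\{i:|a_i|\ge\varepsilon\}$ finite for all $\varepsilon>0$. A continuous surjection $\phi:\widetilde K\to K$ has the $c_0(I)$-extension property if every bounded linear operator from the closed subspace $\{f\circ\phi:f\in C(K)\}$ of $C(\widetilde K)$ into $c_0(I)$ admits a bounded linear extension to $C(\widetilde K)$; the $c_0$-extension property is the case $I=\mathbb N$. *)

theory Defs
  imports "HOL-Analysis.Analysis"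
begin



definition line_on :: "'b set \<Rightarrow> ('b \<times> 'b) set \<Rightarrow> bool" where
  "line_on S r \<longleftrightarrow> linear_order_on S r \<and> r \<subseteq> S \<times> S"

text \<open>Order topology on S induced by r: generated by the open rays
  (together with S itself, so that the topspace is S also in degenerate cases).\<close>
definition order_topology_on :: "'b set \<Rightarrow> ('b \<times> 'b) set \<Rightarrow> 'b topology" where
  "order_topology_on S r = topology_generated_by
     ({S} \<union> {{x \<in> S. (x, a) \<in> r \<and> x \<noteq> a} | a. a \<in> S}
          \<union> {{x \<in> S. (a, x) \<in> r \<and> x \<noteq> a} | a. a \<in> S})"

definition compact_line :: "'b set \<Rightarrow> ('b \<times> 'b) set \<Rightarrow> bool" where
  "compact_line S r \<longleftrightarrow> line_on S r \<and> compact_space (order_topology_on S r)"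

definition lex_omega :: "((nat \<Rightarrow> 'a::linorder) \<times> (nat \<Rightarrow> 'a)) set" where
  "lex_omega = {(x, y). x = y \<or> (\<exists>n. (\<forall>m<n. x m = y m) \<and> x n < y n)}"

definition Cfun :: "'b topology \<Rightarrow> ('b \<Rightarrow> real) set" where
  "Cfun X = {f. continuous_map X euclideanreal f \<and> (\<forall>x. x \<notin> topspace X \<longrightarrow> f x = 0)}"

definition sup_norm_on :: "'b set \<Rightarrow> ('b \<Rightarrow> real) \<Rightarrow> real" where
  "sup_norm_on A f = (SUP x\<in>A. \<bar>f x\<bar>)"

definition c0 :: "'i set \<Rightarrow> ('i \<Rightarrow> real) set" where
  "c0 I = {a. (\<forall>i. i \<notin> I \<longrightarrow> a i = 0) \<and> (\<forall>\<epsilon>>0. finite {i \<in> I. \<bar>a i\<bar> \<ge> \<epsilon>})}"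

definition bounded_linear_op_into_c0 ::
  "'b topology \<Rightarrow> ('b \<Rightarrow> real) set \<Rightarrow> 'i set \<Rightarrow> (('b \<Rightarrow> real) \<Rightarrow> ('i \<Rightarrow> real)) \<Rightarrow> bool" where
  "bounded_linear_op_into_c0 X V I T \<longleftrightarrow>
     (\<forall>f\<in>V. T f \<in> c0 I) \<and>
     (\<forall>f\<in>V. \<forall>g\<in>V. T (\<lambda>x. f x + g x) = (\<lambda>i. T f i + T g i)) \<and>
     (\<forall>c. \<forall>f\<in>V. T (\<lambda>x. c * f x) = (\<lambda>i. c * T f i)) \<and>
     (\<exists>M. \<forall>f\<in>V. sup_norm_on I (T f) \<le> M * sup_norm_on (topspace X) f)"

definition pullback_space :: "'b topology \<Rightarrow> 'c topology \<Rightarrow> ('b \<Rightarrow> 'c) \<Rightarrow> ('b \<Rightarrow> real) set" where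
  "pullback_space Kt K \<phi> = (\<lambda>f x. if x \<in> topspace Kt then f (\<phi> x) else 0) ` Cfun K"

definition c0_extension_property ::
  "'b topology \<Rightarrow> 'c topology \<Rightarrow> ('b \<Rightarrow> 'c) \<Rightarrow> 'i set \<Rightarrow> bool" where
  "c0_extension_property Kt K \<phi> I \<longleftrightarrow>
     (\<forall>T. bounded_linear_op_into_c0 Kt (pullback_space Kt K \<phi>) I T \<longrightarrow>
        (\<exists>S. bounded_linear_op_into_c0 Kt (Cfun Kt) I S \<and>
             (\<forall>f\<in>pullback_space Kt K \<phi>. S f = T f)))"

end

theory Submission
  imports Defs "HOL-Library.Countable_Set_Type"
begin

text \<open>The space \<open>Kt\<close> is \<open>K\<close> with every point of a set \<open>A\<close> doubled. To choose \<open>A\<close>, well-order in type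
  \<open>\<omega>\<^sub>1\<close> a subset \<open>W\<close> of \<open>L\<close> that avoids the maximum, and for each \<open>\<alpha>\<close> in \<open>W\<close> other than the least
  element let the ladder \<open>lad \<alpha>\<close>, a point of \<open>K\<close>, enumerate the predecessors of \<open>\<alpha>\<close>; \<open>A\<close> is the
  set of ladders. A countable subset of \<open>W\<close> contains the entries of only countably many ladders, while
  by a pressing-down argument \<open>A\<close> is far from \<open>\<sigma>\<close>-discrete.

  For operators into \<open>c\<^sub>0(\<nat>)\<close>, extend each coordinate functional by Hahn-Banach. Together these countably
  many functionals have mass on countably many cylinders only, so all but countably many points of \<open>A\<close>
  need no correction; for the remaining ones a diagonal argument in the style of Sobczyk makes the extended
  functionals converge to 0 pointwise.

  For \<open>\<omega>\<^sub>1\<close>, map \<open>f\<close> to the family of its increments over the cylinders of finite prefixes of ladders. It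
  lies in \<open>c\<^sub>0\<close> since a continuous function oscillates by at least \<open>\<epsilon>\<close> on finitely many cylinders only. An
  extension would assign to each \<open>\<alpha>\<close> a finite prefix of \<open>lad \<alpha>\<close> such that, by boundedness, no prefix
  is assigned infinitely often; this contradicts pressing down.\<close>

section \<open>Order topologies\<close>

text \<open>Both halves turn on one fact. Modulo functions pulled back from \<open>K\<close>, the
  step \<open>chi t\<close> at the gap of a doubled point equals \<open>bump t k\<close>, which
  lives over the cylinder of the first \<open>k\<close> entries of \<open>t\<close>. For finitely
  many points and large \<open>k\<close> these cylinders are disjoint, so the bumps add up to a
  function of norm at most 1. Hence a bounded functional that vanishes on the pullback space is
  large on finitely many steps only, which refutes the second extension. In the first, jumps at any
  finite number of points can be removed at the cost of one fixed factor 3, which keeps the operator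
  bounded. The maximum of \<open>L\<close> is avoided so that each point of \<open>A\<close> lies
  strictly below the right end of each of its cylinders. This leaves room for the bump, and it
  excludes an immediate successor, with which the upper copy of the point would coincide.\<close>

locale line =
  fixes S :: "'b set" and r :: "('b \<times> 'b) set"
  assumes line: "line_on S r"
begin

abbreviation le (infix "\<sqsubseteq>" 50) where "x \<sqsubseteq> y \<equiv> (x, y) \<in> r"
abbreviation lt (infix "\<sqsubset>" 50) where "x \<sqsubset> y \<equiv> (x, y) \<in> r \<and> x \<noteq> y"

lemma le_carrier: "x \<sqsubseteq> y \<Longrightarrow> x \<in> S" "x \<sqsubseteq> y \<Longrightarrow> y \<in> S"
  using line unfolding line_on_def by auto

lemma le_refl: "x \<in> S \<Longrightarrow> x \<sqsubseteq> x"
  using line unfolding line_on_def linear_order_on_def partial_order_on_def preorder_on_def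
  by (auto dest: refl_onD)

lemma le_trans: "x \<sqsubseteq> y \<Longrightarrow> y \<sqsubseteq> z \<Longrightarrow> x \<sqsubseteq> z"
  using line unfolding line_on_def linear_order_on_def partial_order_on_def preorder_on_def
  by (auto dest: transD)

lemma le_antisym: "x \<sqsubseteq> y \<Longrightarrow> y \<sqsubseteq> x \<Longrightarrow> x = y"
  using line unfolding line_on_def linear_order_on_def partial_order_on_def
  by (auto dest: antisymD)

lemma le_total: "x \<in> S \<Longrightarrow> y \<in> S \<Longrightarrow> x \<sqsubseteq> y \<or> y \<sqsubset> x"
  using line le_refl unfolding line_on_def linear_order_on_def total_on_def by metis

lemma le_lt_trans: "x \<sqsubseteq> y \<Longrightarrow> y \<sqsubset> z \<Longrightarrow> x \<sqsubset> z"
  using le_trans le_antisym by blast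

lemma lt_le_trans: "x \<sqsubset> y \<Longrightarrow> y \<sqsubseteq> z \<Longrightarrow> x \<sqsubset> z"
  using le_trans le_antisym by blast

abbreviation X where "X \<equiv> order_topology_on S r"

lemma topspace_order: "topspace X = S"
  unfolding order_topology_on_def topology_generated_by_topspace by auto

lemma openin_below: "a \<in> S \<Longrightarrow> openin X {x \<in> S. x \<sqsubset> a}"
  unfolding order_topology_on_def openin_topology_generated_by_iff
  by (rule generate_topology_on.Basis) auto

lemma openin_above: "a \<in> S \<Longrightarrow> openin X {x \<in> S. a \<sqsubset> x}"
  unfolding order_topology_on_def openin_topology_generated_by_iff
  by (rule generate_topology_on.Basis) auto

lemma closedin_atMost: "a \<in> S \<Longrightarrow> closedin X {x \<in> S. x \<sqsubseteq> a}"
proof -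
  assume a: "a \<in> S"
  then have "{x \<in> S. x \<sqsubseteq> a} = topspace X - {x \<in> S. a \<sqsubset> x}"
    using le_total le_antisym by (auto simp: topspace_order)
  then show ?thesis
    using openin_above[OF a] by (simp add: closedin_diff)
qed

lemma closedin_atLeast: "a \<in> S \<Longrightarrow> closedin X {x \<in> S. a \<sqsubseteq> x}"
proof -
  assume a: "a \<in> S"
  then have "{x \<in> S. a \<sqsubseteq> x} = topspace X - {x \<in> S. x \<sqsubset> a}"
    using le_total le_antisym by (auto simp: topspace_order)
  then show ?thesis
    using openin_below[OF a] by (simp add: closedin_diff)
qed

text \<open>Induction on the generation of the topology: under intersections the larger of the two
  left ends works. The point \<open>b\<close> ensures that \<open>x\<close> is not the minimum,
  where no left end exists.\<close>

lemma open_left_interval: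
  assumes "openin X U" "x \<in> U" "b \<in> S" "b \<sqsubset> x"
  shows "\<exists>a\<in>S. a \<sqsubset> x \<and> (\<forall>y. a \<sqsubset> y \<and> y \<sqsubseteq> x \<longrightarrow> y \<in> U)"
proof -
  have "generate_topology_on ({S} \<union> {{x \<in> S. (x, a) \<in> r \<and> x \<noteq> a} | a. a \<in> S}
          \<union> {{x \<in> S. (a, x) \<in> r \<and> x \<noteq> a} | a. a \<in> S}) U"
    using assms(1) unfolding order_topology_on_def openin_topology_generated_by_iff .
  then show ?thesis using assms(2,4)
  proof induction
    case (Int U V)
    then have "x \<in> U" "x \<in> V" by auto
    obtain a where a: "a \<in> S" "a \<sqsubset> x" "\<forall>y. a \<sqsubset> y \<and> y \<sqsubseteq> x \<longrightarrow> y \<in> U"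
      using Int.IH(1)[OF \<open>x \<in> U\<close> Int.prems(2)] by blast
    obtain c where c: "c \<in> S" "c \<sqsubset> x" "\<forall>y. c \<sqsubset> y \<and> y \<sqsubseteq> x \<longrightarrow> y \<in> V"
      using Int.IH(2)[OF \<open>x \<in> V\<close> Int.prems(2)] by blast
    show ?case
    proof (cases "a \<sqsubseteq> c")
      case True
      then have "\<forall>y. c \<sqsubset> y \<and> y \<sqsubseteq> x \<longrightarrow> y \<in> U \<inter> V"
        using a(3) c(3) le_lt_trans[of a c] by blast
      then show ?thesis using c by blast
    next
      case False
      then have "c \<sqsubseteq> a" using le_total a c by blast
      then have "\<forall>y. a \<sqsubset> y \<and> y \<sqsubseteq> x \<longrightarrow> y \<in> U \<inter> V"
        using a(3) c(3) le_lt_trans[of c a] by blast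
      then show ?thesis using a by blast
    qed
  next
    case (UN K)
    then obtain k where k: "k \<in> K" "x \<in> k" by blast
    show ?case using UN.IH[OF k UN.prems(2)] k(1) by blast
  next
    case (Basis U)
    then consider "U = S" | a where "a \<in> S" "U = {x \<in> S. x \<sqsubset> a}"
      | a where "a \<in> S" "U = {x \<in> S. a \<sqsubset> x}" by blast
    then show ?case
    proof cases
      case 1
      then show ?thesis using assms le_carrier by auto
    next
      case 2
      then have "x \<sqsubset> a" using Basis by simp
      then have "y \<in> U" if "y \<sqsubseteq> x" for y
        using that 2 le_carrier[OF that] le_trans[of y x a] le_antisym[of x a] by auto
      then show ?thesis using Basis assms(3) by blast
    next
      case 3
      then show ?thesis using Basis le_carrier
        by (intro bexI[of _ a]) auto
    qed
  qed auto
qed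

lemma line_converse: "line S (r\<inverse>)"
  using line unfolding line_def line_on_def
  by (auto simp: linear_order_on_def partial_order_on_def preorder_on_def)

lemma order_topology_converse: "order_topology_on S (r\<inverse>) = X"
  unfolding order_topology_on_def by (simp add: Un_ac)

lemma open_right_interval:
  assumes "openin X U" "x \<in> U" "b \<in> S" "x \<sqsubset> b"
  shows "\<exists>a\<in>S. x \<sqsubset> a \<and> (\<forall>y. y \<sqsubset> a \<and> x \<sqsubseteq> y \<longrightarrow> y \<in> U)"
proof -
  interpret c: line S "r\<inverse>" by (rule line_converse)
  show ?thesis
    using c.open_left_interval[of U x b] assms by (auto simp: order_topology_converse)
qed

lemma Hausdorff_order: "Hausdorff_space X"
proof -
  have sep: "\<exists>U V. openin X U \<and> openin X V \<and> x \<in> U \<and> y \<in> V \<and> disjnt U V"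
    if "x \<sqsubset> y" for x y
  proof -
    have xy: "x \<in> S" "y \<in> S" using that le_carrier by auto
    show ?thesis
    proof (cases "\<exists>z\<in>S. x \<sqsubset> z \<and> z \<sqsubset> y")
      case True
      then obtain z where z: "z \<in> S" "x \<sqsubset> z" "z \<sqsubset> y" by blast
      show ?thesis
        by (intro exI[of _ "{u \<in> S. u \<sqsubset> z}"] exI[of _ "{u \<in> S. z \<sqsubset> u}"])
           (use z xy openin_above openin_below le_antisym in \<open>auto simp: disjnt_def\<close>)
    next
      case False
      have "disjnt {u \<in> S. u \<sqsubset> y} {u \<in> S. x \<sqsubset> u}"
        using False by (auto simp: disjnt_def)
      then show ?thesis
        by (intro exI[of _ "{u \<in> S. u \<sqsubset> y}"] exI[of _ "{u \<in> S. x \<sqsubset> u}"])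
           (use xy that openin_above openin_below in auto)
    qed
  qed
  show ?thesis
    unfolding Hausdorff_space_def topspace_order
  proof (intro allI impI, elim conjE)
    fix x y assume xy: "x \<in> S" "y \<in> S" "x \<noteq> y"
    show "\<exists>U V. openin X U \<and> openin X V \<and> x \<in> U \<and> y \<in> V \<and> disjnt U V"
    proof (cases "x \<sqsubset> y")
      case False
      then have "y \<sqsubset> x" using le_total xy by blast
      from sep[OF this] show ?thesis by (blast intro: disjnt_sym)
    qed (rule sep)
  qed
qed

end

section \<open>Complete lines: induction, compactness and Urysohn functions\<close>

locale complete_line = line +
  assumes lub: "U \<subseteq> S \<Longrightarrow> \<exists>s\<in>S. (\<forall>x\<in>U. x \<sqsubseteq> s) \<and> (\<forall>y\<in>S. (\<forall>x\<in>U. x \<sqsubseteq> y) \<longrightarrow> s \<sqsubseteq> y)"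
begin

lemma bot_ex: "\<exists>b\<in>S. \<forall>x\<in>S. b \<sqsubseteq> x"
  using lub[of "{}"] by auto

lemma top_ex: "\<exists>t\<in>S. \<forall>x\<in>S. x \<sqsubseteq> t"
  using lub[of S] by auto

text \<open>Induction along a complete line: neighbourhoods advance \<open>P\<close> past limits,
  and \<open>jump\<close> advances it past gaps.\<close>

lemma line_induct:
  assumes bot: "\<And>b. b \<in> S \<Longrightarrow> \<forall>x\<in>S. b \<sqsubseteq> x \<Longrightarrow> P b"
    and near: "\<And>x. x \<in> S \<Longrightarrow> \<exists>U. openin X U \<and> x \<in> U \<and>
        (\<forall>p q. p \<sqsubseteq> q \<and> (\<forall>y. p \<sqsubseteq> y \<and> y \<sqsubseteq> q \<longrightarrow> y \<in> U) \<and> P p \<longrightarrow> P q)"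
    and jump: "\<And>p q. p \<sqsubset> q \<Longrightarrow> \<forall>y. p \<sqsubseteq> y \<and> y \<sqsubseteq> q \<longrightarrow> y = p \<or> y = q \<Longrightarrow> P p \<Longrightarrow> P q"
    and top: "t \<in> S" "\<forall>x\<in>S. x \<sqsubseteq> t"
  shows "P t"
proof -
  \<comment> \<open>The supremum of the points satisfying \<open>P\<close>; it will be shown to
    satisfy \<open>P\<close> and to be the top.\<close>
  obtain s where s: "s \<in> S" "\<And>x. x \<in> S \<Longrightarrow> P x \<Longrightarrow> x \<sqsubseteq> s"
      "\<And>y. y \<in> S \<Longrightarrow> (\<And>x. x \<in> S \<Longrightarrow> P x \<Longrightarrow> x \<sqsubseteq> y) \<Longrightarrow> s \<sqsubseteq> y"
    using lub[of "{x \<in> S. P x}"] by auto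
  obtain b where b: "b \<in> S" "\<forall>x\<in>S. b \<sqsubseteq> x" using bot_ex by blast
  obtain U where U: "openin X U" "s \<in> U"
      "\<And>p q. p \<sqsubseteq> q \<Longrightarrow> \<forall>y. p \<sqsubseteq> y \<and> y \<sqsubseteq> q \<longrightarrow> y \<in> U \<Longrightarrow> P p \<Longrightarrow> P q"
    using near[OF s(1)] by metis
  have Ps: "P s"
  proof (cases "b = s")
    case True
    then show ?thesis using bot b by blast
  next
    case False
    then obtain a where a: "a \<in> S" "a \<sqsubset> s" "\<forall>y. a \<sqsubset> y \<and> y \<sqsubseteq> s \<longrightarrow> y \<in> U"
      using open_left_interval[OF U(1,2) b(1)] b s(1) by auto
    then have "\<not> s \<sqsubseteq> a" using le_antisym by blast
    then obtain p where p: "p \<in> S" "P p" "\<not> p \<sqsubseteq> a"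
      using s(3)[OF a(1)] by blast
    then have "a \<sqsubset> p" using le_total a(1) by blast
    then have "\<forall>y. p \<sqsubseteq> y \<and> y \<sqsubseteq> s \<longrightarrow> y \<in> U"
      using a(3) lt_le_trans[of a p] by blast
    then show ?thesis using U(3)[of p s] p s(2) by blast
  qed
  \<comment> \<open>Below the top, either the neighbourhood of \<open>s\<close> or a gap to its
    right carries \<open>P\<close> beyond \<open>s\<close>, against the choice of
    \<open>s\<close>.\<close>
  show ?thesis
  proof (cases "s = t")
    case False
    then have "s \<sqsubset> t" using top s(1) by blast
    then obtain a where a: "a \<in> S" "s \<sqsubset> a" "\<forall>y. y \<sqsubset> a \<and> s \<sqsubseteq> y \<longrightarrow> y \<in> U"
      using open_right_interval[OF U(1,2) top(1)] by blast
    have "\<exists>q. s \<sqsubset> q \<and> P q"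
    proof (cases "\<exists>q. s \<sqsubset> q \<and> q \<sqsubset> a")
      case True
      then obtain q where q: "s \<sqsubset> q" "q \<sqsubset> a" by blast
      then have "\<forall>y. s \<sqsubseteq> y \<and> y \<sqsubseteq> q \<longrightarrow> y \<in> U"
        using a(3) le_lt_trans[of _ q a] by blast
      then show ?thesis using U(3)[of s q] q Ps by blast
    next
      case False
      then have "P a" using jump[OF a(2) _ Ps] by blast
      then show ?thesis using a by blast
    qed
    then obtain q where "s \<sqsubset> q" "P q" by blast
    then show ?thesis using s(2)[of q] le_antisym[of s q] le_carrier(2)[of s q] by blast
  qed (use Ps in simp)
qed

text \<open>Heine-Borel by \<open>line_induct\<close>: the invariant is that finitely many members
  of the cover suffice up to \<open>x\<close>. A neighbourhood adds one member, a gap at most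
  two.\<close>

lemma compact_space_order: "compact_space X"
  unfolding compact_space_alt topspace_order
proof (intro allI impI, elim conjE)
  fix \<U> assume \<U>: "\<forall>U\<in>\<U>. openin X U" "S \<subseteq> \<Union>\<U>"
  define P where "P x \<longleftrightarrow> (\<exists>\<F>. finite \<F> \<and> \<F> \<subseteq> \<U> \<and> {y. y \<sqsubseteq> x} \<subseteq> \<Union>\<F>)" for x
  have ext: "P q" if "P p" "finite \<F>" "\<F> \<subseteq> \<U>" "\<And>y. p \<sqsubseteq> y \<Longrightarrow> y \<sqsubseteq> q \<Longrightarrow> y \<in> \<Union>\<F>" "p \<in> S" for p q \<F>
  proof -
    obtain \<G> where "finite \<G>" "\<G> \<subseteq> \<U>" "{y. y \<sqsubseteq> p} \<subseteq> \<Union>\<G>" using \<open>P p\<close> unfolding P_def by blast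
    moreover have "y \<in> \<Union>\<G> \<union> \<Union>\<F>" if "y \<sqsubseteq> q" for y
      using \<open>{y. y \<sqsubseteq> p} \<subseteq> \<Union>\<G>\<close> le_total[of y p] le_carrier[OF that] that \<open>p \<in> S\<close>
        \<open>\<And>y. p \<sqsubseteq> y \<Longrightarrow> y \<sqsubseteq> q \<Longrightarrow> y \<in> \<Union>\<F>\<close> by blast
    ultimately show ?thesis
      unfolding P_def using that(2,3) by (intro exI[of _ "\<G> \<union> \<F>"]) (simp add: subset_iff)
  qed
  obtain t where t: "t \<in> S" "\<forall>x\<in>S. x \<sqsubseteq> t" using top_ex by blast
  have "P t"
  proof (rule line_induct[OF _ _ _ t])
    fix b assume b: "b \<in> S" "\<forall>x\<in>S. b \<sqsubseteq> x"
    then obtain U where U: "U \<in> \<U>" "b \<in> U" using \<U> by blast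
    have "{y. y \<sqsubseteq> b} \<subseteq> {b}"
      using b le_carrier le_antisym by blast
    then show "P b" unfolding P_def using U by (intro exI[of _ "{U}"]) auto
  next
    fix x assume "x \<in> S"
    then obtain U where U: "U \<in> \<U>" "x \<in> U" using \<U> by blast
    show "\<exists>U. openin X U \<and> x \<in> U \<and>
        (\<forall>p q. p \<sqsubseteq> q \<and> (\<forall>y. p \<sqsubseteq> y \<and> y \<sqsubseteq> q \<longrightarrow> y \<in> U) \<and> P p \<longrightarrow> P q)"
    proof (intro exI[of _ U] conjI allI impI, goal_cases)
      case (3 p q)
      then show ?case using U ext[of p "{U}" q] le_carrier(1)[of p q] by simp
    qed (use U \<U> in blast)+
  next
    fix p q assume pq: "p \<sqsubset> q" "\<forall>y. p \<sqsubseteq> y \<and> y \<sqsubseteq> q \<longrightarrow> y = p \<or> y = q" "P p"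
    have qS: "p \<in> S" "q \<in> S" using pq le_carrier by auto
    obtain U V where U: "U \<in> \<U>" "q \<in> U" "V \<in> \<U>" "p \<in> V" using \<U> qS by blast
    show "P q"
    proof (rule ext[OF pq(3), of "{U,V}"])
      fix y assume "p \<sqsubseteq> y" "y \<sqsubseteq> q"
      then have "y = p \<or> y = q" using pq(2) by blast
      then show "y \<in> \<Union>{U, V}" using U by blast
    qed (use U qS in blast)+
  qed
  then show "\<exists>\<F>. finite \<F> \<and> \<F> \<subseteq> \<U> \<and> S \<subseteq> \<Union>\<F>"
    unfolding P_def using t(2) by blast
qed

text \<open>Compact Hausdorff spaces are normal, and the two closed rays are disjoint. Resetting the
  function to 0 off \<open>S\<close> meets the convention of \<open>Cfun\<close>.\<close>

lemma urysohn_line: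
  assumes "a \<sqsubset> b"
  obtains h where "h \<in> Cfun X" "\<And>x. 0 \<le> h x \<and> h x \<le> (1::real)"
    "\<And>x. x \<sqsubseteq> a \<Longrightarrow> h x = 0" "\<And>x. b \<sqsubseteq> x \<Longrightarrow> h x = 1"
proof -
  have ab: "a \<in> S" "b \<in> S" using assms le_carrier by auto
  have "normal_space X"
    using compact_Hausdorff_or_regular_imp_normal_space compact_space_order Hausdorff_order by blast
  moreover have "disjnt {x \<in> S. x \<sqsubseteq> a} {x \<in> S. b \<sqsubseteq> x}"
    using assms le_trans[of b _ a] le_antisym[of a b] unfolding disjnt_def by blast
  ultimately obtain f where f: "continuous_map X (top_of_set {0..1}) f"
      "f ` {x \<in> S. x \<sqsubseteq> a} \<subseteq> {0::real}" "f ` {x \<in> S. b \<sqsubseteq> x} \<subseteq> {1}"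
    using Urysohn_lemma[OF _ closedin_atMost[OF ab(1)] closedin_atLeast[OF ab(2)], of 0 1]
    by auto
  define h where "h x = (if x \<in> S then f x else 0)" for x
  have cf: "continuous_map X euclideanreal f" and rng: "\<And>x. x \<in> S \<Longrightarrow> f x \<in> {0..1}"
    using f(1) continuous_map_in_subtopology[of X euclideanreal] by (auto simp: topspace_order)
  have "continuous_map X euclideanreal h"
    by (rule continuous_map_eq[OF cf]) (simp add: h_def topspace_order)
  then have "h \<in> Cfun X" unfolding Cfun_def by (auto simp: h_def topspace_order)
  moreover have "0 \<le> h x \<and> h x \<le> 1" for x using rng by (auto simp: h_def)
  moreover have "h x = 0" if "x \<sqsubseteq> a" for x
    using that f(2) le_carrier[OF that] by (auto simp: h_def)
  moreover have "h x = 1" if "b \<sqsubseteq> x" for x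
    using that f(3) le_carrier[OF that] by (auto simp: h_def)
  ultimately show ?thesis using that by blast
qed

end

section \<open>Continuous functions and bounded functionals\<close>

definition fun_subspace :: "('b \<Rightarrow> real) set \<Rightarrow> bool" where
  "fun_subspace V \<longleftrightarrow> (\<lambda>x. 0) \<in> V \<and> (\<forall>f\<in>V. \<forall>g\<in>V. (\<lambda>x. f x + g x) \<in> V) \<and>
     (\<forall>c. \<forall>f\<in>V. (\<lambda>x. c * f x) \<in> V)"

definition fun_linear_on :: "('b \<Rightarrow> real) set \<Rightarrow> (('b \<Rightarrow> real) \<Rightarrow> real) \<Rightarrow> bool" where
  "fun_linear_on V l \<longleftrightarrow> (\<forall>f\<in>V. \<forall>g\<in>V. l (\<lambda>x. f x + g x) = l f + l g) \<and>
     (\<forall>c. \<forall>f\<in>V. l (\<lambda>x. c * f x) = c * l f)"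

lemma fun_subspaceD:
  assumes "fun_subspace V"
  shows "(\<lambda>x. 0) \<in> V" "f \<in> V \<Longrightarrow> g \<in> V \<Longrightarrow> (\<lambda>x. f x + g x) \<in> V"
    "f \<in> V \<Longrightarrow> (\<lambda>x. c * f x) \<in> V" "f \<in> V \<Longrightarrow> g \<in> V \<Longrightarrow> (\<lambda>x. f x - g x) \<in> V"
proof -
  show *: "(\<lambda>x. 0) \<in> V" "f \<in> V \<Longrightarrow> g \<in> V \<Longrightarrow> (\<lambda>x. f x + g x) \<in> V"
    "f \<in> V \<Longrightarrow> (\<lambda>x. c * f x) \<in> V" for f g c
    using assms unfolding fun_subspace_def by auto
  show "(\<lambda>x. f x - g x) \<in> V" if "f \<in> V" "g \<in> V"
    using *(2)[OF that(1) *(3)[OF that(2), of "-1"]] by simp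
qed

lemma fun_subspace_sum:
  assumes "fun_subspace V" "finite F" "\<And>s. s \<in> F \<Longrightarrow> u s \<in> V"
  shows "(\<lambda>x. \<Sum>s\<in>F. u s x) \<in> V"
  using assms(2,3)
  by (induction F rule: finite_induct) (auto simp: fun_subspaceD[OF assms(1)])

lemma fun_linear_onD:
  assumes "fun_linear_on V l"
  shows "f \<in> V \<Longrightarrow> g \<in> V \<Longrightarrow> l (\<lambda>x. f x + g x) = l f + l g"
    "f \<in> V \<Longrightarrow> l (\<lambda>x. c * f x) = c * l f"
  using assms unfolding fun_linear_on_def by auto

lemma fun_linear_on_sum:
  assumes l: "fun_linear_on V l" and V: "fun_subspace V"
    and F: "finite F" "\<And>s. s \<in> F \<Longrightarrow> u s \<in> V"
  shows "l (\<lambda>x. \<Sum>s\<in>F. u s x) = (\<Sum>s\<in>F. l (u s))"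
  using F
proof (induction F rule: finite_induct)
  case empty
  then show ?case
    using fun_linear_onD(2)[OF l fun_subspaceD(1)[OF V], of 0] by simp
next
  case (insert s F)
  then have "(\<lambda>x. \<Sum>s\<in>F. u s x) \<in> V" by (intro fun_subspace_sum[OF V]) auto
  then show ?case using insert fun_linear_onD(1)[OF l] by simp
qed

text \<open>At the given point at most one summand survives. This is the source of all norm bounds
  that do not depend on the number of summands.\<close>

lemma abs_sum_disjoint_le:
  fixes u :: "'s \<Rightarrow> 'b \<Rightarrow> real"
  assumes F: "finite F" and c: "c \<ge> 0" and u: "\<And>s. s \<in> F \<Longrightarrow> \<bar>u s x\<bar> \<le> c"
    and disj: "\<And>s s'. s \<in> F \<Longrightarrow> s' \<in> F \<Longrightarrow> u s x \<noteq> 0 \<Longrightarrow> u s' x \<noteq> 0 \<Longrightarrow> s = s'"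
  shows "\<bar>\<Sum>s\<in>F. u s x\<bar> \<le> c"
proof (cases "\<exists>s\<in>F. u s x \<noteq> 0")
  case True
  then obtain s where s: "s \<in> F" "u s x \<noteq> 0" by blast
  have "u s' x = 0" if "s' \<in> F - {s}" for s' using that s disj[of s' s] by blast
  then have "(\<Sum>s\<in>F. u s x) = u s x" using sum.remove[OF F s(1), of "\<lambda>s. u s x"] by simp
  then show ?thesis using u[OF s(1)] by simp
qed (use c in simp)

text \<open>Zorn's lemma is applied to graphs instead of functions, so that the upper bound of a
  chain is simply its union.\<close>

theorem Hahn_Banach_fun:
  assumes E: "fun_subspace E" and V: "fun_subspace V" "V \<subseteq> E"
    and l: "fun_linear_on V l" "\<And>f. f \<in> V \<Longrightarrow> l f \<le> p f"
    and p_add: "\<And>f g. f \<in> E \<Longrightarrow> g \<in> E \<Longrightarrow> p (\<lambda>x. f x + g x) \<le> p f + p g"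
    and p_scale: "\<And>c f. f \<in> E \<Longrightarrow> c \<ge> 0 \<Longrightarrow> p (\<lambda>x. c * f x) = c * p f"
  obtains L where "fun_linear_on E L" "\<And>f. f \<in> V \<Longrightarrow> L f = l f" "\<And>f. f \<in> E \<Longrightarrow> L f \<le> p f"
proof -
  text \<open>Dominated linear graphs; domination alone already makes such a graph single-valued.\<close>
  define ok where "ok G \<longleftrightarrow> G \<subseteq> E \<times> UNIV \<and> (\<lambda>f. (f, l f)) ` V \<subseteq> G \<and>
      (\<forall>f a g b. (f, a) \<in> G \<and> (g, b) \<in> G \<longrightarrow> (\<lambda>x. f x + g x, a + b) \<in> G) \<and>
      (\<forall>c f a. (f, a) \<in> G \<longrightarrow> (\<lambda>x. c * f x, c * a) \<in> G) \<and>
      (\<forall>f a. (f, a) \<in> G \<longrightarrow> a \<le> p f)" for G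
  have okE: "G \<subseteq> E \<times> UNIV" and okl: "(\<lambda>f. (f, l f)) ` V \<subseteq> G"
    and ok_add: "(f, a) \<in> G \<Longrightarrow> (g, b) \<in> G \<Longrightarrow> (\<lambda>x. f x + g x, a + b) \<in> G"
    and ok_scale: "(f, a) \<in> G \<Longrightarrow> (\<lambda>x. c * f x, c * a) \<in> G"
    and ok_p: "(f, a) \<in> G \<Longrightarrow> a \<le> p f" if "ok G" for G f a g b c
    using that unfolding ok_def by auto
  have "\<exists>M\<in>Collect ok. \<forall>G\<in>Collect ok. M \<subseteq> G \<longrightarrow> G = M"
  proof (rule subset_Zorn_nonempty)
    show "Collect ok \<noteq> {}"
    proof -
      have "ok ((\<lambda>f. (f, l f)) ` V)"
        unfolding ok_def using V l fun_subspaceD[OF V(1)] fun_linear_onD[OF l(1)]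
        by (fastforce simp: image_iff)
      then show ?thesis by blast
    qed
  next
    fix C assume C: "C \<noteq> {}" "subset.chain (Collect ok) C"
    have okC: "ok G" if "G \<in> C" for G using C that by (auto simp: subset_chain_def)
    have "(\<lambda>x. f x + g x, a + b) \<in> \<Union>C" if fg: "(f, a) \<in> \<Union>C" "(g, b) \<in> \<Union>C" for f a g b
    proof -
      obtain G H where "G \<in> C" "H \<in> C" "(f, a) \<in> G" "(g, b) \<in> H" using fg by blast
      moreover have "G \<subseteq> H \<or> H \<subseteq> G" using C(2) calculation by (auto simp: subset_chain_def)
      ultimately obtain G where "G \<in> C" "(f, a) \<in> G" "(g, b) \<in> G" by blast
      then show ?thesis using ok_add[OF okC] by blast
    qed
    moreover have "\<Union>C \<subseteq> E \<times> UNIV" using okE[OF okC] by blast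
    moreover have "(\<lambda>f. (f, l f)) ` V \<subseteq> \<Union>C" using C(1) okl[OF okC] by blast
    moreover have "(\<lambda>x. c * f x, c * a) \<in> \<Union>C" if "(f, a) \<in> \<Union>C" for c f a
      using ok_scale[OF okC] that by blast
    moreover have "a \<le> p f" if "(f, a) \<in> \<Union>C" for f a
      using ok_p[OF okC] that by blast
    ultimately show "\<Union>C \<in> Collect ok" unfolding ok_def mem_Collect_eq by simp
  qed
  then obtain M where M: "ok M" and max: "\<And>G. ok G \<Longrightarrow> M \<subseteq> G \<Longrightarrow> G = M" by blast
  have ME: "f \<in> E" if "(f, a) \<in> M" for f a using okE[OF M] that by blast
  have Ml: "(f, l f) \<in> M" if "f \<in> V" for f using okl[OF M] that by blast
  note Madd = ok_add[OF M] and Mscale = ok_scale[OF M] and Mp = ok_p[OF M]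
  have M0: "((\<lambda>x. 0), 0) \<in> M"
    using Mscale[OF Ml[OF fun_subspaceD(1)[OF V(1)]], of 0] by simp
  have dom: "\<exists>a. (f0, a) \<in> M" if f0: "f0 \<in> E" for f0
  proof -
    \<comment> \<open>The admissible values at \<open>f0\<close> lie above all left sides and below
      all right sides; this inequality makes room for \<open>a0\<close>.\<close>
    have sep: "a - p (\<lambda>x. f x - f0 x) \<le> p (\<lambda>x. g x + f0 x) - b" if "(f, a) \<in> M" "(g, b) \<in> M" for f g a b
    proof -
      have "a + b \<le> p (\<lambda>x. f x + g x)" using Mp[OF Madd[OF that]] .
      also have "\<dots> = p (\<lambda>x. (f x - f0 x) + (g x + f0 x))" by simp
      also have "\<dots> \<le> p (\<lambda>x. f x - f0 x) + p (\<lambda>x. g x + f0 x)"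
        by (intro p_add fun_subspaceD[OF E] ME[OF that(1)] ME[OF that(2)] f0)
      finally show ?thesis by simp
    qed
    define a0 where "a0 = (SUP (f, a)\<in>M. a - p (\<lambda>x. f x - f0 x))"
    have lo: "a - p (\<lambda>x. f x - f0 x) \<le> a0" if "(f, a) \<in> M" for f a
      unfolding a0_def
      by (rule cSUP_upper2[OF _ that]) (use sep[OF _ M0] in \<open>auto intro!: bdd_aboveI2\<close>)
    have hi: "a0 \<le> p (\<lambda>x. g x + f0 x) - b" if "(g, b) \<in> M" for g b
      unfolding a0_def by (rule cSUP_least) (use M0 sep[OF _ that] in auto)
    define G where "G = {(\<lambda>x. f x + c * f0 x, a + c * a0) | f a c. (f, a) \<in> M}"
    have "M \<subseteq> G"
    proof
      fix z assume "z \<in> M"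
      then show "z \<in> G" unfolding G_def mem_Collect_eq
        by (intro exI[of _ "fst z"] exI[of _ "snd z"] exI[of _ 0]) simp
    qed
    moreover have "ok G"
      unfolding ok_def
    proof (intro conjI allI impI)
      show "G \<subseteq> E \<times> UNIV"
        unfolding G_def using ME f0 fun_subspaceD[OF E] by auto
      show "(\<lambda>f. (f, l f)) ` V \<subseteq> G" using Ml \<open>M \<subseteq> G\<close> by auto
    next
      fix f a g b assume "(f, a) \<in> G \<and> (g, b) \<in> G"
      then obtain f1 a1 c1 g1 b1 c2 where
        1: "(f1, a1) \<in> M" "f = (\<lambda>x. f1 x + c1 * f0 x)" "a = a1 + c1 * a0"
        "(g1, b1) \<in> M" "g = (\<lambda>x. g1 x + c2 * f0 x)" "b = b1 + c2 * a0"
        unfolding G_def by auto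
      show "(\<lambda>x. f x + g x, a + b) \<in> G"
        unfolding G_def mem_Collect_eq using Madd[OF 1(1,4)] 1
        by (intro exI[of _ "\<lambda>x. f1 x + g1 x"] exI[of _ "a1 + b1"] exI[of _ "c1 + c2"])
           (simp add: algebra_simps)
    next
      fix c f a assume "(f, a) \<in> G"
      then obtain f1 a1 c1 where
        1: "(f1, a1) \<in> M" "f = (\<lambda>x. f1 x + c1 * f0 x)" "a = a1 + c1 * a0"
        unfolding G_def by auto
      show "(\<lambda>x. c * f x, c * a) \<in> G"
        unfolding G_def mem_Collect_eq using Mscale[OF 1(1), of c] 1
        by (intro exI[of _ "\<lambda>x. c * f1 x"] exI[of _ "c * a1"] exI[of _ "c * c1"])
           (simp add: algebra_simps)
    next
      fix f a assume "(f, a) \<in> G"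
      then obtain f1 a1 c where
        1: "(f1, a1) \<in> M" "f = (\<lambda>x. f1 x + c * f0 x)" "a = a1 + c * a0"
        unfolding G_def by auto
      \<comment> \<open>Dividing by the absolute value of \<open>c\<close> reduces to the
        coefficients 1 and -1, where \<open>hi\<close> and \<open>lo\<close> apply.\<close>
      consider "c = 0" | "c > 0" | "c < 0" by linarith
      then show "a \<le> p f"
      proof cases
        case 1
        then show ?thesis using Mp \<open>(f1, a1) \<in> M\<close> \<open>f = _\<close> \<open>a = _\<close> by simp
      next
        case 2
        have "f = (\<lambda>x. c * (1 / c * f1 x + f0 x))" using 1 2 by (simp add: algebra_simps)
        moreover have "(\<lambda>x. 1 / c * f1 x + f0 x) \<in> E"
          using ME[OF 1(1)] f0 fun_subspaceD[OF E] by blast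
        ultimately have "p f = c * p (\<lambda>x. 1 / c * f1 x + f0 x)"
          using p_scale[of "\<lambda>x. 1 / c * f1 x + f0 x" c] 2 by simp
        moreover have "c * a0 \<le> c * (p (\<lambda>x. 1 / c * f1 x + f0 x) - 1 / c * a1)"
          using hi[OF Mscale[OF 1(1), of "1 / c"]] 2 by (intro mult_left_mono) auto
        ultimately show ?thesis using 1(3) 2 by (simp add: algebra_simps)
      next
        case 3
        have "f = (\<lambda>x. (-c) * ((-1 / c) * f1 x - f0 x))" using 1 3 by (simp add: algebra_simps)
        moreover have "(\<lambda>x. (-1 / c) * f1 x - f0 x) \<in> E"
          using ME[OF 1(1)] f0 fun_subspaceD[OF E] by blast
        ultimately have "p f = (-c) * p (\<lambda>x. (-1 / c) * f1 x - f0 x)"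
          using p_scale[of "\<lambda>x. (-1 / c) * f1 x - f0 x" "-c"] 3 by simp
        moreover have "(-c) * ((-1 / c) * a1 - p (\<lambda>x. (-1 / c) * f1 x - f0 x)) \<le> (-c) * a0"
          using lo[OF Mscale[OF 1(1), of "-1 / c"]] 3 by (intro mult_left_mono) auto
        ultimately show ?thesis using 1(3) 3 by (simp add: algebra_simps)
      qed
    qed
    ultimately have "G = M" using max by blast
    moreover have "(f0, a0) \<in> G"
      unfolding G_def mem_Collect_eq
      by (rule exI[of _ "\<lambda>x. 0"], rule exI[of _ 0], rule exI[of _ 1]) (use M0 in auto)
    ultimately show ?thesis by blast
  qed
  have uniq: "a = b" if "(f, a) \<in> M" "(f, b) \<in> M" for f a b
  proof -
    have "(\<lambda>x. 0, a - b) \<in> M"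
      using Madd[OF that(1) Mscale[OF that(2), of "-1"]] by simp
    moreover have "p (\<lambda>x. 0) = 0"
      using p_scale[OF fun_subspaceD(1)[OF E], of 0] by simp
    moreover have "(\<lambda>x. 0, b - a) \<in> M"
      using Madd[OF that(2) Mscale[OF that(1), of "-1"]] by simp
    ultimately show ?thesis using Mp[of "\<lambda>x. 0" "a - b"] Mp[of "\<lambda>x. 0" "b - a"] by linarith
  qed
  define L where "L f = (THE a. (f, a) \<in> M)" for f
  have L: "L f = a" if "(f, a) \<in> M" for f a
    unfolding L_def using that uniq by blast
  have L': "(f, L f) \<in> M" if "f \<in> E" for f
    using dom[OF that] L by blast
  show ?thesis
  proof (rule that[of L])
    show "fun_linear_on E L"
      unfolding fun_linear_on_def by (blast intro: L[OF Madd[OF L' L']] L[OF Mscale[OF L']])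
  qed (use L Ml L' Mp in auto)
qed

lemma fun_subspace_Cfun: "fun_subspace (Cfun X)"
  unfolding fun_subspace_def Cfun_def
  by (auto intro: continuous_map_add continuous_map_real_mult_left)

context
  fixes X :: "'b topology"
  assumes X: "compact_space X" "topspace X \<noteq> {}"
begin

lemma Cfun_bounded:
  assumes "f \<in> Cfun X" shows "bdd_above ((\<lambda>x. \<bar>f x\<bar>) ` topspace X)"
proof -
  have "compactin euclideanreal (f ` topspace X)"
    using assms X(1) image_compactin[of X "topspace X" euclideanreal f]
    by (auto simp: Cfun_def compact_space_def)
  then have "bounded (f ` topspace X)" by (simp add: compact_imp_bounded)
  then obtain B where "\<And>x. x \<in> topspace X \<Longrightarrow> \<bar>f x\<bar> \<le> B"
    unfolding bounded_iff by auto
  then show ?thesis by (intro bdd_aboveI2) auto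
qed

lemma sup_norm_nonneg: "f \<in> Cfun X \<Longrightarrow> 0 \<le> sup_norm_on (topspace X) f"
  using X(2) Cfun_bounded unfolding sup_norm_on_def
  by (meson abs_ge_zero cSUP_upper2 ex_in_conv)

lemma abs_le_sup_norm:
  assumes "f \<in> Cfun X" shows "\<bar>f x\<bar> \<le> sup_norm_on (topspace X) f"
proof (cases "x \<in> topspace X")
  case True
  then show ?thesis unfolding sup_norm_on_def by (rule cSUP_upper[OF _ Cfun_bounded[OF assms]])
next
  case False
  then show ?thesis using assms sup_norm_nonneg by (auto simp: Cfun_def)
qed

lemma sup_norm_le: "(\<And>x. x \<in> topspace X \<Longrightarrow> \<bar>f x\<bar> \<le> c) \<Longrightarrow> sup_norm_on (topspace X) f \<le> c"
  using X(2) unfolding sup_norm_on_def by (rule cSUP_least)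

lemma sup_norm_scale:
  assumes "f \<in> Cfun X" "c \<ge> 0"
  shows "sup_norm_on (topspace X) (\<lambda>x. c * f x) = c * sup_norm_on (topspace X) f"
proof (rule antisym)
  show "sup_norm_on (topspace X) (\<lambda>x. c * f x) \<le> c * sup_norm_on (topspace X) f"
    using assms abs_le_sup_norm by (intro sup_norm_le) (auto simp: abs_mult intro!: mult_left_mono)
  have cf: "(\<lambda>x. c * f x) \<in> Cfun X" using assms(1) fun_subspaceD(3)[OF fun_subspace_Cfun] by blast
  show "c * sup_norm_on (topspace X) f \<le> sup_norm_on (topspace X) (\<lambda>x. c * f x)"
  proof (cases "c = 0")
    case True
    then show ?thesis using sup_norm_nonneg[OF cf] by simp
  next
    case False
    then have "\<bar>f x\<bar> \<le> sup_norm_on (topspace X) (\<lambda>x. c * f x) / c" for x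
      using abs_le_sup_norm[OF cf, of x] assms(2) by (simp add: field_simps abs_mult)
    then have "sup_norm_on (topspace X) f \<le> sup_norm_on (topspace X) (\<lambda>x. c * f x) / c"
      by (rule sup_norm_le)
    then show ?thesis using assms(2) False by (simp add: field_simps)
  qed
qed

text \<open>For a bounded functional, disjoint pieces that carry a nonzero value are countably many,
  since any finite number of them adds up to a function of norm at most one.\<close>

lemma countable_disjoint_support:
  assumes \<nu>: "fun_linear_on (Cfun X) \<nu>" "\<And>f. f \<in> Cfun X \<Longrightarrow> \<nu> f \<le> M * sup_norm_on (topspace X) f"
    and disj: "\<And>x s s'. s \<in> J \<Longrightarrow> s' \<in> J \<Longrightarrow> x \<in> C s \<Longrightarrow> x \<in> C s' \<Longrightarrow> s = s'"
  shows "countable {s \<in> J. \<exists>u\<in>Cfun X. (\<forall>x. \<bar>u x\<bar> \<le> 1) \<and> (\<forall>x. u x \<noteq> 0 \<longrightarrow> x \<in> C s) \<and> \<nu> u \<noteq> 0}"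
    (is "countable ?B")
proof -
  define B where "B i = {s \<in> J. \<exists>u\<in>Cfun X. (\<forall>x. \<bar>u x\<bar> \<le> 1) \<and> (\<forall>x. u x \<noteq> 0 \<longrightarrow> x \<in> C s) \<and>
      \<nu> u > inverse (real (Suc i))}" for i
  have "?B \<subseteq> (\<Union>i. B i)"
  proof
    fix s assume "s \<in> ?B"
    then obtain u where u: "s \<in> J" "u \<in> Cfun X" "\<forall>x. \<bar>u x\<bar> \<le> 1" "\<forall>x. u x \<noteq> 0 \<longrightarrow> x \<in> C s" "\<nu> u \<noteq> 0"
      by blast
    \<comment> \<open>Changing the sign where necessary makes all values positive, so that they
      cannot cancel in a sum.\<close>
    have "\<exists>v\<in>Cfun X. (\<forall>x. \<bar>v x\<bar> \<le> 1) \<and> (\<forall>x. v x \<noteq> 0 \<longrightarrow> x \<in> C s) \<and> \<nu> v > 0"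
    proof (cases "\<nu> u > 0")
      case False
      then show ?thesis using u fun_linear_onD(2)[OF \<nu>(1) u(2), of "-1"]
          fun_subspaceD(3)[OF fun_subspace_Cfun u(2), of "-1"]
        by (intro bexI[of _ "\<lambda>x. -1 * u x"]) auto
    qed (use u in blast)
    then obtain v where v: "v \<in> Cfun X" "\<forall>x. \<bar>v x\<bar> \<le> 1" "\<forall>x. v x \<noteq> 0 \<longrightarrow> x \<in> C s" "\<nu> v > 0"
      by blast
    obtain i where "inverse (real (Suc i)) < \<nu> v" using reals_Archimedean[OF v(4)] by auto
    then show "s \<in> (\<Union>i. B i)" unfolding B_def using v u(1) by blast
  qed
  moreover have "finite (B i)" for i
  proof -
    \<comment> \<open>The sum over \<open>F\<close> has norm at most 1 but value at least
      \<open>card F / Suc i\<close>, and the functional is bounded by \<open>M\<close>.\<close>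
    have "card F \<le> nat \<lceil>\<bar>M\<bar> * real (Suc i)\<rceil>" if F: "finite F" "F \<subseteq> B i" for F
    proof -
      have "\<forall>s\<in>F. \<exists>u\<in>Cfun X. (\<forall>x. \<bar>u x\<bar> \<le> 1) \<and> (\<forall>x. u x \<noteq> 0 \<longrightarrow> x \<in> C s) \<and>
          \<nu> u > inverse (real (Suc i))" using F unfolding B_def by blast
      then obtain u where u: "\<And>s. s \<in> F \<Longrightarrow> u s \<in> Cfun X" "\<And>s x. s \<in> F \<Longrightarrow> \<bar>u s x\<bar> \<le> 1"
          "\<And>s x. s \<in> F \<Longrightarrow> u s x \<noteq> 0 \<Longrightarrow> x \<in> C s" "\<And>s. s \<in> F \<Longrightarrow> \<nu> (u s) > inverse (real (Suc i))"
        by metis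
      define g where "g x = (\<Sum>s\<in>F. u s x)" for x
      have g: "g \<in> Cfun X" unfolding g_def using u F(1) by (intro fun_subspace_sum fun_subspace_Cfun)
      have "\<bar>g x\<bar> \<le> 1" for x
        unfolding g_def
      proof (rule abs_sum_disjoint_le[OF F(1)])
        fix s s' assume ss: "s \<in> F" "s' \<in> F" "u s x \<noteq> 0" "u s' x \<noteq> 0"
        then have "s \<in> J" "s' \<in> J" using F(2) unfolding B_def by auto
        then show "s = s'" using disj u(3)[OF ss(1,3)] u(3)[OF ss(2,4)] by blast
      qed (use u(2) in auto)
      then have "sup_norm_on (topspace X) g \<le> 1" by (intro sup_norm_le)
      then have "M * sup_norm_on (topspace X) g \<le> \<bar>M\<bar>"
        using sup_norm_nonneg[OF g] mult_right_mono[of M "\<bar>M\<bar>" "sup_norm_on (topspace X) g"]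
          mult_left_mono[of "sup_norm_on (topspace X) g" 1 "\<bar>M\<bar>"] by linarith
      then have "\<nu> g \<le> \<bar>M\<bar>" using \<nu>(2)[OF g] by linarith
      moreover have "\<nu> g = (\<Sum>s\<in>F. \<nu> (u s))"
        unfolding g_def using u F(1) by (intro fun_linear_on_sum[OF \<nu>(1)] fun_subspace_Cfun)
      moreover have "(\<Sum>s\<in>F. \<nu> (u s)) \<ge> (\<Sum>s\<in>F. inverse (real (Suc i)))"
        using u(4) by (intro sum_mono) (simp add: less_imp_le)
      ultimately have "real (card F) * inverse (real (Suc i)) \<le> \<bar>M\<bar>" by simp
      then have "real (card F) \<le> \<bar>M\<bar> * real (Suc i)" by (simp add: field_simps)
      then show ?thesis by linarith
    qed
    then show ?thesis
      using finite_if_finite_subsets_card_bdd[of "B i" "nat \<lceil>\<bar>M\<bar> * real (Suc i)\<rceil>"] by auto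
  qed
  then have "countable (\<Union>i. B i)" by (simp add: countable_finite)
  ultimately show ?thesis by (rule countable_subset)
qed

end

text \<open>A real supremum bounds its members only if the set is bounded above; it is, because only
  finitely many coordinates reach 1.\<close>

lemma c0_abs_le_sup_norm:
  assumes "a \<in> c0 I" "i \<in> I"
  shows "\<bar>a i\<bar> \<le> sup_norm_on I a"
proof -
  have "finite ((\<lambda>i. \<bar>a i\<bar>) ` {i \<in> I. \<bar>a i\<bar> \<ge> 1})" using assms unfolding c0_def by auto
  then have "bdd_above ((\<lambda>i. \<bar>a i\<bar>) ` {i \<in> I. \<bar>a i\<bar> \<ge> 1})" by (rule bdd_above_finite)
  then obtain B where B: "\<forall>b\<in>(\<lambda>i. \<bar>a i\<bar>) ` {i \<in> I. \<bar>a i\<bar> \<ge> 1}. b \<le> B"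
    unfolding bdd_above_def by blast
  have "bdd_above ((\<lambda>i. \<bar>a i\<bar>) ` I)"
    by (rule bdd_aboveI2[of _ _ "max 1 B"]) (use B in force)
  then show ?thesis unfolding sup_norm_on_def using assms(2) by (intro cSUP_upper)
qed

section \<open>Splitting points of a complete line\<close>

text \<open>If \<open>t\<close> had an immediate successor \<open>x\<close>, the closed ray up to
  \<open>t\<close> would be the open ray below \<open>x\<close>, and doubling \<open>t\<close> would
  add no new point.\<close>

locale split_line = complete_line "UNIV :: 'k set" R for R :: "('k \<times> 'k) set" +
  fixes A :: "'k set"
  assumes no_successor: "t \<in> A \<Longrightarrow> (t, x) \<in> R \<Longrightarrow> t \<noteq> x \<Longrightarrow>
      \<exists>z. ((t, z) \<in> R \<and> t \<noteq> z) \<and> (z, x) \<in> R \<and> z \<noteq> x"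
begin

notation le (infix "\<sqsubseteq>" 50)
notation lt (infix "\<sqsubset>" 50)

text \<open>Points of the split line are encoded as initial segments, like Dedekind cuts, so that
  its order is inclusion and suprema are unions. Doubling \<open>t\<close> opens the gap between
  \<open>lower t\<close> and \<open>upper t\<close>.\<close>

definition lower :: "'k \<Rightarrow> 'k \<Rightarrow> bool" where "lower x = (\<lambda>y. y \<sqsubset> x)"
definition upper :: "'k \<Rightarrow> 'k \<Rightarrow> bool" where "upper x = (\<lambda>y. y \<sqsubseteq> x)"
definition Kt :: "('k \<Rightarrow> bool) set" where "Kt = range lower \<union> upper ` A"
definition rt :: "(('k \<Rightarrow> bool) \<times> ('k \<Rightarrow> bool)) set" where
  "rt = {(P, Q). P \<in> Kt \<and> Q \<in> Kt \<and> P \<le> Q}"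

lemma lower_le_lower: "lower x \<le> lower y \<longleftrightarrow> x \<sqsubseteq> y"
proof
  assume *: "lower x \<le> lower y"
  show "x \<sqsubseteq> y"
  proof (rule ccontr)
    assume "\<not> x \<sqsubseteq> y"
    then have "y \<sqsubset> x" using le_total[of x y] by blast
    then have "lower x y" by (simp add: lower_def)
    then have "lower y y" using * by (simp add: le_fun_def le_bool_def)
    then show False by (simp add: lower_def)
  qed
next
  assume "x \<sqsubseteq> y"
  then show "lower x \<le> lower y"
    using lt_le_trans[of _ x y] unfolding le_fun_def le_bool_def lower_def by blast
qed

lemma upper_le_lower: "upper x \<le> lower y \<longleftrightarrow> x \<sqsubset> y"
proof
  assume *: "upper x \<le> lower y"
  have "upper x x" using le_refl by (simp add: upper_def)
  then have "lower y x" using * by (simp add: le_fun_def le_bool_def)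
  then show "x \<sqsubset> y" by (simp add: lower_def)
next
  assume "x \<sqsubset> y"
  then show "upper x \<le> lower y"
    using le_lt_trans[of _ x y] unfolding le_fun_def le_bool_def upper_def lower_def by blast
qed

text \<open>Here \<open>no_successor\<close> enters: if \<open>y\<close> is below \<open>x\<close>,
  a point strictly between them belongs to \<open>lower x\<close> but not to
  \<open>upper y\<close>.\<close>

lemma lower_le_upper: "y \<in> A \<Longrightarrow> lower x \<le> upper y \<longleftrightarrow> x \<sqsubseteq> y"
proof
  assume y: "y \<in> A" and *: "lower x \<le> upper y"
  show "x \<sqsubseteq> y"
  proof (rule ccontr)
    assume "\<not> x \<sqsubseteq> y"
    then have "y \<sqsubset> x" using le_total[of x y] by blast
    then obtain z where z: "y \<sqsubset> z" "z \<sqsubset> x" using no_successor[OF y] by blast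
    then have "lower x z" by (simp add: lower_def)
    then have "upper y z" using * by (simp add: le_fun_def le_bool_def)
    then show False using z le_antisym by (auto simp: upper_def)
  qed
next
  assume "x \<sqsubseteq> y"
  then show "lower x \<le> upper y"
    using le_trans[of _ x y] unfolding le_fun_def le_bool_def lower_def upper_def by blast
qed

lemma upper_le_upper: "upper x \<le> upper y \<longleftrightarrow> x \<sqsubseteq> y"
  using le_refl le_trans[of _ x y] unfolding le_fun_def le_bool_def upper_def by blast

lemmas split_le = lower_le_lower upper_le_lower lower_le_upper upper_le_upper

lemma lower_in_Kt: "lower x \<in> Kt" and upper_in_Kt: "x \<in> A \<Longrightarrow> upper x \<in> Kt"
  by (auto simp: Kt_def)

lemma Kt_cases [consumes 1]:
  assumes "P \<in> Kt"
  obtains x where "P = lower x" | x where "x \<in> A" "P = upper x"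
  using assms unfolding Kt_def by blast

lemma Kt_down:
  assumes "P \<in> Kt" "P y" "z \<sqsubseteq> y" shows "P z"
  using assms(1)
proof (cases rule: Kt_cases)
  case (1 x)
  then show ?thesis using assms(2) le_lt_trans[OF assms(3), of x] by (simp add: lower_def)
next
  case (2 x)
  then show ?thesis using assms(2) le_trans[OF assms(3), of x] by (simp add: upper_def)
qed

lemma Kt_total: "P \<in> Kt \<Longrightarrow> Q \<in> Kt \<Longrightarrow> P \<le> Q \<or> Q \<le> P"
proof (rule ccontr)
  assume PQ: "P \<in> Kt" "Q \<in> Kt" "\<not> (P \<le> Q \<or> Q \<le> P)"
  then obtain y z where "P y" "\<not> Q y" "Q z" "\<not> P z" by (auto simp: le_fun_def)
  then show False using Kt_down[OF PQ(1), of y z] Kt_down[OF PQ(2), of z y] le_total[of y z] by blast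
qed

text \<open>A down-set is of the form \<open>lower s\<close> or \<open>upper s\<close> with \<open>s\<close> its supremum, so a union of
  points of \<open>Kt\<close> is again in \<open>Kt\<close>: in the second case \<open>s\<close> is attained by one of them.\<close>

lemma Union_in_Kt:
  assumes "\<U> \<subseteq> Kt"
  shows "(\<lambda>y. \<exists>P\<in>\<U>. P y) \<in> Kt" (is "?U \<in> Kt")
proof -
  obtain s where s: "\<And>x. ?U x \<Longrightarrow> x \<sqsubseteq> s" "\<And>y. (\<And>x. ?U x \<Longrightarrow> x \<sqsubseteq> y) \<Longrightarrow> s \<sqsubseteq> y"
    using lub[of "{x. ?U x}"] by auto
  show ?thesis
  proof (cases "?U s")
    case True
    then obtain P where P: "P \<in> \<U>" "P s" by blast
    then have "P = ?U"
      using s(1) Kt_down[of P s] assms by (intro ext) blast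
    then show ?thesis using P assms by auto
  next
    case False
    have "?U y \<longleftrightarrow> lower s y" for y
    proof
      assume "?U y"
      then show "lower s y" using s(1) False unfolding lower_def by blast
    next
      assume y: "lower s y"
      show "?U y"
      proof (rule ccontr)
        assume "\<not> ?U y"
        then have "x \<sqsubseteq> y" if "?U x" for x
          using Kt_down[of _ x y] assms that le_total[of x y] by blast
        then have "s \<sqsubseteq> y" by (rule s(2))
        then show False using y le_antisym unfolding lower_def by blast
      qed
    qed
    then have "?U = lower s" by (rule ext)
    then show ?thesis using lower_in_Kt by simp
  qed
qed

sublocale T: complete_line Kt rt
proof
  show "line_on Kt rt"
    unfolding line_on_def linear_order_on_def partial_order_on_def preorder_on_def
    by (auto simp: rt_def refl_on_def trans_def antisym_def total_on_def dest: Kt_total)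
next
  fix \<U> assume U: "\<U> \<subseteq> Kt"
  show "\<exists>s\<in>Kt. (\<forall>x\<in>\<U>. (x, s) \<in> rt) \<and> (\<forall>y\<in>Kt. (\<forall>x\<in>\<U>. (x, y) \<in> rt) \<longrightarrow> (s, y) \<in> rt)"
    using Union_in_Kt[OF U] U
    by (intro bexI[of _ "\<lambda>y. \<exists>P\<in>\<U>. P y"]) (auto simp: rt_def le_fun_def)
qed

lemma upper_neq_lower: "x \<in> A \<Longrightarrow> upper x \<noteq> lower y"
  using lower_le_upper[of x y] upper_le_lower[of x y] le_antisym by (metis order_refl)

lemma split_rt:
  "(lower x, lower y) \<in> rt \<longleftrightarrow> x \<sqsubseteq> y"
  "y \<in> A \<Longrightarrow> (lower x, upper y) \<in> rt \<longleftrightarrow> x \<sqsubseteq> y"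
  "x \<in> A \<Longrightarrow> (upper x, lower y) \<in> rt \<longleftrightarrow> x \<sqsubset> y"
  "x \<in> A \<Longrightarrow> y \<in> A \<Longrightarrow> (upper x, upper y) \<in> rt \<longleftrightarrow> x \<sqsubseteq> y"
  unfolding rt_def by (simp_all add: split_le lower_in_Kt upper_in_Kt)

lemma split_eq:
  "lower x = lower y \<longleftrightarrow> x = y"
  "upper x = upper y \<longleftrightarrow> x = y"
  "x \<in> A \<Longrightarrow> upper x \<noteq> lower y" "x \<in> A \<Longrightarrow> lower y \<noteq> upper x"
  using lower_le_lower[of x y] lower_le_lower[of y x] upper_le_upper[of x y] upper_le_upper[of y x]
    le_antisym[of x y] upper_neq_lower by (force, force, metis, metis)

lemma Ball_KtI:
  "(\<And>x. Q (lower x)) \<Longrightarrow> (\<And>x. x \<in> A \<Longrightarrow> Q (upper x)) \<Longrightarrow> \<forall>P\<in>Kt. Q P"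
  unfolding Kt_def by blast

text \<open>This is the surjection onto \<open>K\<close> of the theorem; it forgets which copy of a
  point is meant.\<close>

definition base :: "('k \<Rightarrow> bool) \<Rightarrow> 'k" where
  "base P = (SOME x. P = lower x \<or> x \<in> A \<and> P = upper x)"

lemma base_lower [simp]: "base (lower x) = x"
  unfolding base_def
proof (rule some_equality)
  fix y assume "lower x = lower y \<or> y \<in> A \<and> lower x = upper y"
  then have "lower x = lower y" using upper_neq_lower by metis
  then show "y = x" using lower_le_lower[of x y] lower_le_lower[of y x] le_antisym by simp
qed simp

lemma base_upper [simp]: "x \<in> A \<Longrightarrow> base (upper x) = x"
  unfolding base_def
proof (rule some_equality)
  fix y assume "x \<in> A" "upper x = lower y \<or> y \<in> A \<and> upper x = upper y"
  then have "upper x = upper y" using upper_neq_lower by metis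
  then show "y = x" using upper_le_upper[of x y] upper_le_upper[of y x] le_antisym by simp
qed simp

lemma base_mono: "(P, Q) \<in> rt \<Longrightarrow> base P \<sqsubseteq> base Q"
proof -
  have "\<forall>P\<in>Kt. \<forall>Q\<in>Kt. (P, Q) \<in> rt \<longrightarrow> base P \<sqsubseteq> base Q"
    by (intro Ball_KtI) (simp_all add: split_rt)
  then show "(P, Q) \<in> rt \<Longrightarrow> base P \<sqsubseteq> base Q" using T.le_carrier by blast
qed

lemma base_surj: "base ` Kt = UNIV"
proof -
  have "x \<in> base ` Kt" for x by (rule image_eqI[of _ _ "lower x"]) (simp_all add: lower_in_Kt)
  then show ?thesis by blast
qed

lemma continuous_base: "continuous_map T.X X base"
  unfolding order_topology_on_def[of UNIV R]
proof (rule continuous_on_generated_topo)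
  fix U assume "U \<in> {UNIV} \<union> {{x \<in> UNIV. (x, a) \<in> R \<and> x \<noteq> a} |a. a \<in> UNIV} \<union>
      {{x \<in> UNIV. (a, x) \<in> R \<and> x \<noteq> a} |a. a \<in> UNIV}"
  then consider "U = UNIV" | a where "U = {x. x \<sqsubset> a}" | a where "U = {x. a \<sqsubset> x}" by blast
  then show "openin T.X (base -` U \<inter> topspace T.X)"
  proof cases
    case 1
    then show ?thesis by simp
  next
    case 2
    have "\<forall>P\<in>Kt. base P \<sqsubset> a \<longleftrightarrow> (P, lower a) \<in> rt \<and> P \<noteq> lower a"
      by (intro Ball_KtI) (simp_all add: split_rt split_eq)
    then have "base -` U \<inter> topspace T.X = {P \<in> Kt. (P, lower a) \<in> rt \<and> P \<noteq> lower a}"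
      unfolding 2 T.topspace_order by blast
    then show ?thesis using T.openin_below[OF lower_in_Kt] by simp
  next
    case 3
    \<comment> \<open>The preimage of the ray above \<open>a\<close> begins after the last copy of
      \<open>a\<close>.\<close>
    define Q where "Q = (if a \<in> A then upper a else lower a)"
    have "\<forall>P\<in>Kt. a \<sqsubset> base P \<longleftrightarrow> (Q, P) \<in> rt \<and> P \<noteq> Q"
      by (intro Ball_KtI; cases "a \<in> A") (auto simp: Q_def split_rt split_eq)
    then have "base -` U \<inter> topspace T.X = {P \<in> Kt. (Q, P) \<in> rt \<and> Q \<noteq> P}"
      unfolding 3 T.topspace_order by blast
    moreover have "Q \<in> Kt" by (simp add: Q_def lower_in_Kt upper_in_Kt)
    ultimately show ?thesis using T.openin_above[of Q] by simp
  qed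
qed auto

definition pull :: "('k \<Rightarrow> real) \<Rightarrow> ('k \<Rightarrow> bool) \<Rightarrow> real" where
  "pull g P = (if P \<in> Kt then g (base P) else 0)"

text \<open>For \<open>t \<in> A\<close> this is the indicator of everything to the right of the gap
  at \<open>t\<close>, a clopen set.\<close>

definition chi :: "'k \<Rightarrow> ('k \<Rightarrow> bool) \<Rightarrow> real" where
  "chi t P = (if P \<in> Kt \<and> P t then 1 else 0)"

lemma pullback_space_pull: "pullback_space T.X X base = pull ` Cfun X"
  unfolding pullback_space_def pull_def T.topspace_order ..

lemma pull_in_Cfun: "g \<in> Cfun X \<Longrightarrow> pull g \<in> Cfun T.X"
proof -
  assume "g \<in> Cfun X"
  then have "continuous_map X euclideanreal g" by (simp add: Cfun_def)
  then have "continuous_map T.X euclideanreal (g \<circ> base)"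
    by (rule continuous_map_compose[OF continuous_base])
  then have "continuous_map T.X euclideanreal (pull g)"
    by (rule continuous_map_eq) (simp add: pull_def T.topspace_order)
  then show ?thesis by (simp add: Cfun_def pull_def T.topspace_order)
qed

lemma pull_lower [simp]: "pull g (lower x) = g x"
  and pull_upper [simp]: "x \<in> A \<Longrightarrow> pull g (upper x) = g x"
  by (simp_all add: pull_def lower_in_Kt upper_in_Kt)

lemma chi_lower [simp]: "chi t (lower x) = (if t \<sqsubset> x then 1 else 0)"
  and chi_upper [simp]: "x \<in> A \<Longrightarrow> chi t (upper x) = (if t \<sqsubseteq> x then 1 else 0)"
  by (simp_all add: chi_def lower_in_Kt upper_in_Kt) (simp_all add: lower_def upper_def)

text \<open>The set where the value is 1 is the open ray above \<open>lower t\<close>, and its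
  complement is the open ray below \<open>upper t\<close>.\<close>

lemma chi_in_Cfun:
  assumes "t \<in> A" shows "chi t \<in> Cfun T.X"
proof -
  have "\<forall>P\<in>Kt. P t \<longleftrightarrow> (lower t, P) \<in> rt \<and> lower t \<noteq> P"
    using assms by (intro Ball_KtI) (auto simp: split_rt split_eq fun_cong[OF lower_def] fun_cong[OF upper_def])
  then have "{P \<in> Kt. P t} = {P \<in> Kt. (lower t, P) \<in> rt \<and> lower t \<noteq> P}"
    by (intro Collect_cong conj_cong refl) (drule (1) bspec, assumption)
  then have 1: "openin T.X {P \<in> Kt. P t}" using T.openin_above[OF lower_in_Kt] by simp
  have "\<forall>P\<in>Kt. \<not> P t \<longleftrightarrow> (P, upper t) \<in> rt \<and> P \<noteq> upper t"
  proof (intro Ball_KtI)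
    fix x show "\<not> lower x t \<longleftrightarrow> (lower x, upper t) \<in> rt \<and> lower x \<noteq> upper t"
      using assms le_total[of x t] le_antisym[of x t] le_refl[of x]
      by (simp add: split_rt split_eq fun_cong[OF lower_def]) blast
    assume "x \<in> A"
    then show "\<not> upper x t \<longleftrightarrow> (upper x, upper t) \<in> rt \<and> upper x \<noteq> upper t"
      using assms le_total[of x t] le_antisym[of x t] le_total[of t x] le_refl[of x]
      by (simp add: split_rt split_eq fun_cong[OF upper_def]) blast
  qed
  then have "{P \<in> Kt. \<not> P t} = {P \<in> Kt. (P, upper t) \<in> rt \<and> P \<noteq> upper t}"
    by (intro Collect_cong conj_cong refl) (drule (1) bspec, assumption)
  then have 2: "openin T.X {P \<in> Kt. \<not> P t}" using T.openin_below[OF upper_in_Kt[OF assms]] by simp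
  have "openin T.X {P \<in> Kt. chi t P \<in> U}" for U
  proof -
    have "{P \<in> Kt. chi t P \<in> U} =
        (if 1 \<in> U then {P \<in> Kt. P t} else {}) \<union> (if 0 \<in> U then {P \<in> Kt. \<not> P t} else {})"
      by (auto simp: chi_def)
    then show ?thesis using 1 2 by auto
  qed
  then show ?thesis
    unfolding Cfun_def continuous_map_def by (auto simp: T.topspace_order chi_def)
qed

lemma const_in_Cfun: "(\<lambda>x. c) \<in> Cfun X"
  by (simp add: Cfun_def topspace_order)

text \<open>Take \<open>h\<close> rising from 0 at \<open>t\<close> to 1 at \<open>b\<close>. The
  difference inherits the unit jump at \<open>t\<close> and vanishes before \<open>t\<close> and
  from \<open>b\<close> on.\<close>

lemma tent:
  assumes "t \<in> A" "t \<sqsubset> b"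
  obtains h where "h \<in> Cfun X" "\<And>P. \<bar>chi t P - pull h P\<bar> \<le> 1"
    "\<And>P. chi t P - pull h P \<noteq> 0 \<Longrightarrow> P \<in> Kt \<and> t \<sqsubseteq> base P \<and> base P \<sqsubset> b"
proof -
  obtain h where h: "h \<in> Cfun X" "\<And>x. 0 \<le> h x \<and> h x \<le> 1"
    "\<And>x. x \<sqsubseteq> t \<Longrightarrow> h x = 0" "\<And>x. b \<sqsubseteq> x \<Longrightarrow> h x = 1"
    by (rule urysohn_line[OF assms(2)]) (rule that)
  show ?thesis
  proof (rule that[OF h(1)])
    fix P
    show "\<bar>chi t P - pull h P\<bar> \<le> 1"
      using h(2)[of "base P"] by (auto simp: chi_def pull_def)
    assume nz: "chi t P - pull h P \<noteq> 0"
    then have P: "P \<in> Kt" by (auto simp: chi_def pull_def split: if_splits)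
    then have *: "if t \<sqsubset> base P then 1 \<noteq> h (base P) else base P = t \<or> h (base P) \<noteq> 0"
      using nz by (auto elim!: Kt_cases split: if_splits)
    have "t \<sqsubseteq> base P" using * h(3)[of "base P"] le_total[of t "base P"] le_refl[of t] by (auto split: if_splits)
    moreover have "base P \<sqsubset> b"
    proof (rule ccontr)
      assume "\<not> base P \<sqsubset> b"
      then have "b \<sqsubseteq> base P" using le_total[of b "base P"] le_refl by blast
      moreover then have "t \<sqsubset> base P" using lt_le_trans assms(2) by blast
      ultimately show False using * h(4) by simp
    qed
    ultimately show "P \<in> Kt \<and> t \<sqsubseteq> base P \<and> base P \<sqsubset> b" using P by blast
  qed
qed

text \<open>Two distinct points over the same base are the two sides of a gap, which
  \<open>chi\<close> separates. Otherwise the bases are separated by a continuous function on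
  \<open>K\<close>.\<close>

lemma split_urysohn:
  assumes "(P, Q) \<in> rt" "P \<noteq> Q"
    and D: "pull ` Cfun X \<subseteq> D" "chi ` A \<subseteq> D"
  obtains h where "h \<in> D" "\<And>Z. 0 \<le> h Z \<and> h Z \<le> 1" "\<And>Z. (Z, P) \<in> rt \<Longrightarrow> h Z = 0"
    "\<And>Z. (Q, Z) \<in> rt \<Longrightarrow> h Z = 1"
proof (cases "base P = base Q")
  case True
  have "\<forall>P\<in>Kt. \<forall>Q\<in>Kt. (P, Q) \<in> rt \<and> P \<noteq> Q \<and> base P = base Q \<longrightarrow>
      (\<exists>t\<in>A. P = lower t \<and> Q = upper t)"
    by (intro Ball_KtI) (simp_all add: split_rt split_eq)
  then obtain t where t: "t \<in> A" "P = lower t" "Q = upper t"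
    using assms(1,2) True T.le_carrier[OF assms(1)] by blast
  show ?thesis
  proof (rule that[of "chi t"])
    show "chi t \<in> D" using D t by blast
    show "0 \<le> chi t Z \<and> chi t Z \<le> 1" for Z by (simp add: chi_def)
    show "chi t Z = 0" if "(Z, P) \<in> rt" for Z
      using that unfolding t rt_def by (auto simp: chi_def lower_def le_fun_def)
    show "chi t Z = 1" if "(Q, Z) \<in> rt" for Z
      using that le_refl unfolding t rt_def by (auto simp: chi_def upper_def le_fun_def)
  qed
next
  case False
  then have "base P \<sqsubset> base Q" using base_mono[OF assms(1)] by blast
  then obtain h where h: "h \<in> Cfun X" "\<And>x. 0 \<le> h x \<and> h x \<le> 1"
    "\<And>x. x \<sqsubseteq> base P \<Longrightarrow> h x = 0" "\<And>x. base Q \<sqsubseteq> x \<Longrightarrow> h x = 1"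
    by (rule urysohn_line) (rule that)
  show ?thesis
  proof (rule that[of "pull h"])
    show "pull h \<in> D" using D h by blast
    show "0 \<le> pull h Z \<and> pull h Z \<le> 1" for Z using h(2) by (simp add: pull_def)
    show "pull h Z = 0" if "(Z, P) \<in> rt" for Z
      using h(3) base_mono[OF that] by (simp add: pull_def)
    show "pull h Z = 1" if "(Q, Z) \<in> rt" for Z
      using h(4) base_mono[OF that] T.le_carrier[OF that] by (simp add: pull_def)
  qed
qed

text \<open>The approximation follows \<open>f\<close> along the line: each step from
  \<open>p\<close> to \<open>q\<close> adds \<open>f q - f p\<close> times a transition function.
  Since \<open>D\<close> may be any class closed under sums and multiples, the lemma transfers a
  property from pullbacks and steps to a dense class.\<close>

lemma dense_span:
  assumes f: "f \<in> Cfun T.X" and \<epsilon>: "\<epsilon> > 0"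
    and D: "pull ` Cfun X \<subseteq> D" "chi ` A \<subseteq> D"
    and add: "\<And>d e. d \<in> D \<Longrightarrow> e \<in> D \<Longrightarrow> (\<lambda>x. d x + e x) \<in> D"
    and scale: "\<And>c d. d \<in> D \<Longrightarrow> (\<lambda>x. c * d x) \<in> D"
  obtains d where "d \<in> D" "\<And>P. P \<in> Kt \<Longrightarrow> \<bar>f P - d P\<bar> \<le> \<epsilon>"
proof -
  \<comment> \<open>The approximant is frozen at the exact value \<open>f p\<close> from
    \<open>p\<close> on, so errors do not accumulate from step to step.\<close>
  define G where "G p \<longleftrightarrow> (\<exists>d\<in>D. (\<forall>y. (y, p) \<in> rt \<longrightarrow> \<bar>f y - d y\<bar> \<le> \<epsilon>) \<and>
      (\<forall>y. (p, y) \<in> rt \<longrightarrow> d y = f p))" for p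
  have step: "G q" if pq: "(p, q) \<in> rt" "p \<noteq> q" and Gp: "G p"
    and near: "\<And>y s. (p, y) \<in> rt \<Longrightarrow> (y, q) \<in> rt \<Longrightarrow> 0 \<le> s \<Longrightarrow> s \<le> 1 \<Longrightarrow>
      (y = p \<Longrightarrow> s = 0) \<Longrightarrow> (y = q \<Longrightarrow> s = 1) \<Longrightarrow> \<bar>f y - (f p + (f q - f p) * s)\<bar> \<le> \<epsilon>" for p q
  proof -
    obtain d where d: "d \<in> D" "\<And>y. (y, p) \<in> rt \<Longrightarrow> \<bar>f y - d y\<bar> \<le> \<epsilon>" "\<And>y. (p, y) \<in> rt \<Longrightarrow> d y = f p"
      using Gp unfolding G_def by blast
    obtain h where h: "h \<in> D" "\<And>Z. 0 \<le> h Z \<and> h Z \<le> 1" "\<And>Z. (Z, p) \<in> rt \<Longrightarrow> h Z = 0"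
      "\<And>Z. (q, Z) \<in> rt \<Longrightarrow> h Z = 1" by (rule split_urysohn[OF pq D]) (rule that)
    have carr: "p \<in> Kt" "q \<in> Kt" using pq T.le_carrier by auto
    define e where "e = (\<lambda>y. d y + (f q - f p) * h y)"
    have "e \<in> D" unfolding e_def using add[OF d(1) scale[OF h(1)]] .
    moreover have "\<bar>f y - e y\<bar> \<le> \<epsilon>" if y: "(y, q) \<in> rt" for y
    proof (cases "(y, p) \<in> rt")
      case True
      then show ?thesis using d(2) h(3) by (simp add: e_def)
    next
      case False
      then have py: "(p, y) \<in> rt" using T.le_total[of y p] carr T.le_carrier[OF y] by blast
      have "\<bar>f y - (f p + (f q - f p) * h y)\<bar> \<le> \<epsilon>"
        using h(2)[of y] h(3)[of y] h(4)[of y] T.le_refl carr by (intro near[OF py y]) auto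
      then show ?thesis using d(3)[OF py] by (simp add: e_def)
    qed
    moreover have "e y = f q" if "(q, y) \<in> rt" for y
      using d(3)[OF T.le_trans[OF pq(1) that]] h(4)[OF that] by (simp add: e_def)
    ultimately show ?thesis unfolding G_def by blast
  qed
  obtain t where t: "t \<in> Kt" "\<forall>x\<in>Kt. (x, t) \<in> rt" using T.top_ex by blast
  have "G t"
  proof (rule T.line_induct[OF _ _ _ t])
    fix b assume b: "b \<in> Kt" "\<forall>x\<in>Kt. (b, x) \<in> rt"
    have "pull (\<lambda>x. f b) \<in> D" using D const_in_Cfun by blast
    moreover have "\<bar>f y - pull (\<lambda>x. f b) y\<bar> \<le> \<epsilon>" if "(y, b) \<in> rt" for y
    proof -
      have "y = b" using b(2) T.le_carrier[OF that] T.le_antisym[OF that] by blast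
      then show ?thesis using \<epsilon> b(1) by (simp add: pull_def)
    qed
    moreover have "pull (\<lambda>x. f b) y = f b" if "(b, y) \<in> rt" for y
      using T.le_carrier[OF that] by (simp add: pull_def)
    ultimately show "G b" unfolding G_def by blast
  next
    fix x assume x: "x \<in> Kt"
    define U where "U = {y \<in> topspace T.X. f y \<in> ball (f x) (\<epsilon>/2)}"
    have "openin T.X U" unfolding U_def
      using f openin_continuous_map_preimage[of T.X euclideanreal f "ball (f x) (\<epsilon>/2)"]
      by (simp add: Cfun_def)
    moreover have "x \<in> U" using x \<epsilon> by (simp add: U_def T.topspace_order)
    moreover have "G q" if pq: "(p, q) \<in> rt" "\<forall>y. (p, y) \<in> rt \<and> (y, q) \<in> rt \<longrightarrow> y \<in> U" "G p" for p q
    proof (cases "p = q")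
      case False
      have near: "\<bar>f y - f x\<bar> < \<epsilon>/2" if "(p, y) \<in> rt" "(y, q) \<in> rt" for y
      proof -
        have "y \<in> U" using pq(2) that by blast
        then show ?thesis by (simp add: U_def dist_real_def abs_minus_commute)
      qed
      have pqU: "\<bar>f p - f x\<bar> < \<epsilon>/2" "\<bar>f q - f x\<bar> < \<epsilon>/2"
        using near pq(1) T.le_refl T.le_carrier[OF pq(1)] by blast+
      show ?thesis
      proof (rule step[OF pq(1) False pq(3)])
        fix y and s :: real assume y: "(p, y) \<in> rt" "(y, q) \<in> rt" and s: "0 \<le> s" "s \<le> 1"
        have "\<bar>f y - f x\<bar> < \<epsilon>/2" using near y by blast
        \<comment> \<open>The transition value is a convex combination of \<open>f p\<close> and
          \<open>f q\<close>, so it is as close to \<open>f x\<close> as they are.\<close>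
        moreover have "f p + (f q - f p) * s - f x = (1 - s) * (f p - f x) + s * (f q - f x)"
          by (simp add: algebra_simps)
        moreover have "\<bar>(1 - s) * (f p - f x) + s * (f q - f x)\<bar> \<le> \<epsilon>/2"
        proof -
          have "\<bar>(1 - s) * (f p - f x)\<bar> \<le> (1 - s) * (\<epsilon>/2)"
            unfolding abs_mult using s pqU by (intro mult_mono) auto
          moreover have "\<bar>s * (f q - f x)\<bar> \<le> s * (\<epsilon>/2)"
            unfolding abs_mult using s pqU by (intro mult_mono) auto
          ultimately show ?thesis
            using abs_triangle_ineq[of "(1 - s) * (f p - f x)" "s * (f q - f x)"]
            by (simp add: algebra_simps)
        qed
        ultimately show "\<bar>f y - (f p + (f q - f p) * s)\<bar> \<le> \<epsilon>" by linarith
      qed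
    qed (use pq in simp)
    ultimately show "\<exists>U. openin T.X U \<and> x \<in> U \<and>
        (\<forall>p q. (p, q) \<in> rt \<and> (\<forall>y. (p, y) \<in> rt \<and> (y, q) \<in> rt \<longrightarrow> y \<in> U) \<and> G p \<longrightarrow> G q)" by blast
  next
    fix p q assume pq: "(p, q) \<in> rt \<and> p \<noteq> q" "\<forall>y. (p, y) \<in> rt \<and> (y, q) \<in> rt \<longrightarrow> y = p \<or> y = q" "G p"
    show "G q"
    proof (rule step)
      fix y and s :: real assume "(p, y) \<in> rt" "(y, q) \<in> rt" "y = p \<Longrightarrow> s = 0" "y = q \<Longrightarrow> s = 1"
      then show "\<bar>f y - (f p + (f q - f p) * s)\<bar> \<le> \<epsilon>"
        using pq(2) \<epsilon> by auto
    qed (use pq in auto)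
  qed
  then show ?thesis unfolding G_def using t(2) that by blast
qed

end

section \<open>The lexicographic order\<close>

lemma first_difference:
  fixes x y :: "nat \<Rightarrow> 'a"
  assumes "x \<noteq> y"
  obtains n where "\<forall>m<n. x m = y m" "x n \<noteq> y n"
proof -
  have "\<exists>n. x n \<noteq> y n" using assms by auto
  then show ?thesis
    using that[of "LEAST n. x n \<noteq> y n"] not_less_Least[of _ "\<lambda>n. x n \<noteq> y n"]
      LeastI_ex[of "\<lambda>n. x n \<noteq> y n"] by blast
qed

lemma lex_strict:
  fixes x y :: "nat \<Rightarrow> 'a::linorder"
  assumes "\<forall>m<n. x m = y m" "x n \<noteq> y n"
  shows "(x, y) \<in> lex_omega \<longleftrightarrow> x n < y n"
proof
  assume "(x, y) \<in> lex_omega"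
  then obtain k where k: "\<forall>m<k. x m = y m" "x k < y k"
    using assms(2) unfolding lex_omega_def by auto
  then have "k = n" using assms by (metis less_irrefl nat_neq_iff)
  then show "x n < y n" using k by simp
next
  assume "x n < y n"
  then show "(x, y) \<in> lex_omega" using assms(1) unfolding lex_omega_def by blast
qed

lemma line_lex_omega: "line_on UNIV (lex_omega :: ((nat \<Rightarrow> 'a::linorder) \<times> (nat \<Rightarrow> 'a)) set)"
proof -
  have refl: "(x, x) \<in> lex_omega" for x :: "nat \<Rightarrow> 'a" by (simp add: lex_omega_def)
  have antisym: "x = y" if "(x, y) \<in> lex_omega" "(y, x) \<in> lex_omega" for x y :: "nat \<Rightarrow> 'a"
  proof (rule ccontr)
    assume "x \<noteq> y"
    then obtain n where n: "\<forall>m<n. x m = y m" "x n \<noteq> y n" by (rule first_difference)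
    then show False using that lex_strict[of n x y] lex_strict[of n y x] by auto
  qed
  have total: "(x, y) \<in> lex_omega \<or> (y, x) \<in> lex_omega" if "x \<noteq> y" for x y :: "nat \<Rightarrow> 'a"
  proof -
    obtain n where n: "\<forall>m<n. x m = y m" "x n \<noteq> y n" using first_difference[OF \<open>x \<noteq> y\<close>] .
    then show ?thesis using lex_strict[of n x y] lex_strict[of n y x] by auto
  qed
  have trans: "(x, z) \<in> lex_omega" if xyz: "(x, y) \<in> lex_omega" "(y, z) \<in> lex_omega" for x y z :: "nat \<Rightarrow> 'a"
  proof (cases "x = y \<or> y = z")
    case False
    then obtain k l where kl: "\<forall>m<k. x m = y m" "x k < y k" "\<forall>m<l. y m = z m" "y l < z l"
      using xyz unfolding lex_omega_def by auto
    have "\<forall>m<min k l. x m = z m" using kl by simp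
    moreover have "x (min k l) < z (min k l)"
      using kl by (cases k l rule: linorder_cases) (auto simp: min_def)
    ultimately show ?thesis unfolding lex_omega_def by blast
  qed (use xyz in auto)
  show ?thesis
    unfolding line_on_def linear_order_on_def partial_order_on_def preorder_on_def
  proof (intro conjI)
    show "refl_on UNIV (lex_omega :: ((nat \<Rightarrow> 'a) \<times> (nat \<Rightarrow> 'a)) set)"
      by (rule refl_onI) (rule refl)
    show "trans (lex_omega :: ((nat \<Rightarrow> 'a) \<times> (nat \<Rightarrow> 'a)) set)"
      by (rule transI) (rule trans)
    show "antisym (lex_omega :: ((nat \<Rightarrow> 'a) \<times> (nat \<Rightarrow> 'a)) set)"
      by (rule antisymI) (rule antisym)
    show "total (lex_omega :: ((nat \<Rightarrow> 'a) \<times> (nat \<Rightarrow> 'a)) set)"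
      unfolding total_on_def using total by blast
  qed auto
qed

text \<open>The supremum of \<open>U\<close> is built coordinate by coordinate: its \<open>n\<close>-th entry is the supremum of
  the \<open>n\<close>-th entries of those members of \<open>U\<close> that agree with it so far.\<close>

lemma complete_line_lex_omega:
  assumes lub: "\<And>U :: 'a::linorder set. \<exists>s. (\<forall>x\<in>U. x \<le> s) \<and> (\<forall>y. (\<forall>x\<in>U. x \<le> y) \<longrightarrow> s \<le> y)"
  shows "complete_line UNIV (lex_omega :: ((nat \<Rightarrow> 'a) \<times> (nat \<Rightarrow> 'a)) set)"
proof -
  interpret line "UNIV :: (nat \<Rightarrow> 'a) set" lex_omega
    by unfold_locales (rule line_lex_omega)
  show ?thesis
  proof
    fix U :: "(nat \<Rightarrow> 'a) set"
    define V where "V f n = {x n | x. x \<in> U \<and> (\<forall>m<n. x m = f m)}" for f n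
    \<comment> \<open>\<open>V s n\<close> depends on \<open>s\<close> only through the coordinates
      before \<open>n\<close>, which allows choice along the well-founded order of the
      indices.\<close>
    have "\<exists>s. \<forall>n. (\<forall>x\<in>V s n. x \<le> s n) \<and> (\<forall>y. (\<forall>x\<in>V s n. x \<le> y) \<longrightarrow> s n \<le> y)"
    proof (rule dependent_wf_choice[OF wf_less])
      fix f g :: "nat \<Rightarrow> 'a" and n r
      assume "\<And>z. (z, n) \<in> {(x, y). x < y} \<Longrightarrow> f z = g z"
      then have "V f n = V g n" unfolding V_def by auto
      then show "((\<forall>x\<in>V f n. x \<le> r) \<and> (\<forall>y. (\<forall>x\<in>V f n. x \<le> y) \<longrightarrow> r \<le> y)) =
          ((\<forall>x\<in>V g n. x \<le> r) \<and> (\<forall>y. (\<forall>x\<in>V g n. x \<le> y) \<longrightarrow> r \<le> y))" by simp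
    qed (rule lub)
    then obtain s where s: "\<And>n x. x \<in> V s n \<Longrightarrow> x \<le> s n"
      "\<And>n y. (\<And>x. x \<in> V s n \<Longrightarrow> x \<le> y) \<Longrightarrow> s n \<le> y" by blast
    have "(x, s) \<in> lex_omega" if "x \<in> U" for x
    proof (cases "x = s")
      case False
      then obtain n where n: "\<forall>m<n. x m = s m" "x n \<noteq> s n" by (rule first_difference)
      then have "x n \<in> V s n" using that unfolding V_def by blast
      then show ?thesis using s(1) n lex_strict[OF n] by force
    qed (simp add: lex_omega_def)
    moreover have "(s, y) \<in> lex_omega" if y: "\<forall>x\<in>U. (x, y) \<in> lex_omega" for y
    proof (rule ccontr)
      assume neg: "(s, y) \<notin> lex_omega"
      then have "s \<noteq> y" by (auto simp: lex_omega_def)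
      then obtain n where n: "\<forall>m<n. s m = y m" "s n \<noteq> y n" by (rule first_difference)
      then have "y n < s n" using neg lex_strict[OF n] by auto
      then obtain v where v: "v \<in> V s n" "y n < v" using s(2)[of n "y n"] by (meson leD leI)
      then obtain x where x: "x \<in> U" "\<forall>m<n. x m = s m" "x n > y n" unfolding V_def by blast
      then have "(x, y) \<in> lex_omega" "\<forall>m<n. x m = y m" using y n by simp_all
      then show False using lex_strict[of n x y] x(3) by simp
    qed
    ultimately show "\<exists>s\<in>UNIV. (\<forall>x\<in>U. (x, s) \<in> lex_omega) \<and>
        (\<forall>y\<in>UNIV. (\<forall>x\<in>U. (x, y) \<in> lex_omega) \<longrightarrow> (s, y) \<in> lex_omega)" by blast
  qed
qed

text \<open>The maximum of the closure of \<open>U\<close> is its supremum, because every ray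
  \<open>{..y}\<close> is closed. For empty \<open>U\<close> the minimum of the line is
  needed.\<close>

lemma compact_UNIV_lub:
  assumes "compact (UNIV :: 'a::linorder_topology set)"
  shows "\<exists>s::'a. (\<forall>x\<in>U. x \<le> s) \<and> (\<forall>y. (\<forall>x\<in>U. x \<le> y) \<longrightarrow> s \<le> y)"
proof (cases "U = {}")
  case True
  then show ?thesis using compact_attains_inf[OF assms] by auto
next
  case False
  have "compact (closure U)" using assms compact_Int_closed[of UNIV "closure U"] by simp
  then obtain m where m: "m \<in> closure U" "\<forall>x\<in>closure U. x \<le> m"
    using compact_attains_sup[of "closure U"] False by auto
  have "m \<le> y" if "\<forall>x\<in>U. x \<le> y" for y
  proof -
    have "closure U \<subseteq> {..y}" using that by (intro closure_minimal) auto
    then show ?thesis using m by auto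
  qed
  then show ?thesis using m closure_subset by blast
qed

section \<open>Prefixes, cylinders and their end points\<close>

definition prefix_of :: "(nat \<Rightarrow> 'a) \<Rightarrow> nat \<Rightarrow> 'a list" where "prefix_of x k = map x [0..<k]"
definition extend :: "'a list \<Rightarrow> 'a \<Rightarrow> nat \<Rightarrow> 'a" where
  "extend s c = (\<lambda>i. if i < length s then s ! i else c)"
definition cylinder :: "'a list \<Rightarrow> (nat \<Rightarrow> 'a) set" where "cylinder s = {x. \<forall>i<length s. x i = s ! i}"

lemma length_prefix_of [simp]: "length (prefix_of x k) = k"
  by (simp add: prefix_of_def)

lemma nth_prefix_of [simp]: "i < k \<Longrightarrow> prefix_of x k ! i = x i"
  by (simp add: prefix_of_def)

lemma set_prefix_of: "set (prefix_of x k) \<subseteq> range x"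
  by (auto simp: prefix_of_def)

lemma in_cylinder_prefix_of: "x \<in> cylinder s \<longleftrightarrow> s = prefix_of x (length s)"
  unfolding cylinder_def by (auto simp: list_eq_iff_nth_eq)

lemma prefix_of_eq_iff: "prefix_of x k = prefix_of y k \<longleftrightarrow> (\<forall>i<k. x i = y i)"
  by (auto simp: list_eq_iff_nth_eq)

lemma extend_prefix_of: "extend (prefix_of x k) c i = (if i < k then x i else c)"
  by (simp add: extend_def)

locale lex_line = complete_line "UNIV :: (nat \<Rightarrow> 'a::linorder) set" lex_omega +
  fixes lo hi :: "'a::linorder"
  assumes lo: "lo \<le> x" and hi: "x \<le> hi"
begin

notation le (infix "\<sqsubseteq>" 50)
notation lt (infix "\<sqsubset>" 50)

text \<open>A member first differs from an end only past the prefix, where that end has the least or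
  greatest possible entry. A point outside already differs within the prefix, where both ends
  agree.\<close>

lemma cylinder_iff: "x \<in> cylinder s \<longleftrightarrow> extend s lo \<sqsubseteq> x \<and> x \<sqsubseteq> extend s hi"
proof
  assume x: "x \<in> cylinder s"
  have *: "length s \<le> n" "n < length s \<Longrightarrow> False" if "x n \<noteq> extend s c n" for n c
    using that x unfolding cylinder_def extend_def by (auto split: if_splits intro: leI)
  have "extend s lo \<sqsubseteq> x"
  proof (cases "extend s lo = x")
    case False
    then obtain n where n: "\<forall>m<n. extend s lo m = x m" "extend s lo n \<noteq> x n" by (rule first_difference)
    then show ?thesis using lex_strict[OF n] *[of n lo] lo[of "x n"] by (force simp: extend_def)
  qed (simp add: le_refl)
  moreover have "x \<sqsubseteq> extend s hi"
  proof (cases "x = extend s hi")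
    case False
    then obtain n where n: "\<forall>m<n. x m = extend s hi m" "x n \<noteq> extend s hi n" by (rule first_difference)
    then show ?thesis using lex_strict[OF n] *[of n hi] hi[of "x n"] by (force simp: extend_def)
  qed (simp add: le_refl)
  ultimately show "extend s lo \<sqsubseteq> x \<and> x \<sqsubseteq> extend s hi" by blast
next
  assume le: "extend s lo \<sqsubseteq> x \<and> x \<sqsubseteq> extend s hi"
  show "x \<in> cylinder s"
  proof (rule ccontr)
    assume "x \<notin> cylinder s"
    then obtain i where i: "i < length s" "x i \<noteq> s ! i" unfolding cylinder_def by auto
    have ne: "x \<noteq> extend s lo" using i by (auto simp: extend_def fun_eq_iff)
    obtain n where n: "\<forall>m<n. x m = extend s lo m" "x n \<noteq> extend s lo n"
      using first_difference[OF ne] .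
    \<comment> \<open>So \<open>n\<close> is still inside the prefix: both ends have the same entry
      there, and \<open>x n\<close> would have to lie strictly above and strictly below it.\<close>
    have "n \<le> i" using n(1) i by (auto simp: extend_def not_le[symmetric])
    then have *: "extend s lo m = extend s hi m" if "m \<le> n" for m
      using that i by (simp add: extend_def)
    have "\<forall>m<n. extend s lo m = x m" "\<forall>m<n. x m = extend s hi m" using n(1) * by auto
    then have "extend s lo n < x n" "x n < extend s hi n"
      using le n(2) lex_strict[of n "extend s lo" x] lex_strict[of n x "extend s hi"] *[of n] by auto
    then show False using *[of n] by simp
  qed
qed

lemma extend_lo_le_hi: "extend s lo \<sqsubseteq> extend s hi"
proof -
  have "extend s lo \<in> cylinder s" by (simp add: cylinder_def extend_def)
  then show ?thesis by (simp add: cylinder_iff)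
qed

lemma in_own_cylinder: "x \<in> cylinder (prefix_of x k)"
  by (simp add: in_cylinder_prefix_of)

lemma prefix_cylinder: "extend (prefix_of x k) lo \<sqsubseteq> x" "x \<sqsubseteq> extend (prefix_of x k) hi"
  using in_own_cylinder[of x k] unfolding cylinder_iff by blast+

text \<open>Once the prefix of \<open>b\<close> includes the first coordinate where \<open>a\<close>
  and \<open>b\<close> differ, its continuation no longer affects the comparison; hence the bound is
  one more than that coordinate.\<close>

lemma eventually_lo_above:
  assumes "a \<sqsubset> b" obtains n where "\<And>k. k \<ge> n \<Longrightarrow> a \<sqsubset> extend (prefix_of b k) lo"
proof -
  obtain n where n: "\<forall>m<n. a m = b m" "a n \<noteq> b n" using assms first_difference by metis
  have "a \<sqsubset> extend (prefix_of b k) lo" if "k \<ge> Suc n" for k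
  proof -
    have *: "\<forall>m<n. a m = extend (prefix_of b k) lo m" "a n < extend (prefix_of b k) lo n"
      using n that assms lex_strict[OF n] by (auto simp: extend_prefix_of)
    then have "a \<noteq> extend (prefix_of b k) lo" by (metis less_irrefl)
    then show ?thesis using * lex_strict[OF *(1)] by simp
  qed
  then show ?thesis by (rule that)
qed

lemma eventually_hi_below:
  assumes "b \<sqsubset> c" obtains n where "\<And>k. k \<ge> n \<Longrightarrow> extend (prefix_of b k) hi \<sqsubset> c"
proof -
  obtain n where n: "\<forall>m<n. b m = c m" "b n \<noteq> c n" using assms first_difference by metis
  have "extend (prefix_of b k) hi \<sqsubset> c" if "k \<ge> Suc n" for k
  proof -
    have *: "\<forall>m<n. extend (prefix_of b k) hi m = c m" "extend (prefix_of b k) hi n < c n"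
      using n that assms lex_strict[OF n] by (auto simp: extend_prefix_of)
    then have "extend (prefix_of b k) hi \<noteq> c" by (metis less_irrefl)
    then show ?thesis using * lex_strict[OF *(1)] by simp
  qed
  then show ?thesis by (rule that)
qed

lemma lt_extend_hi:
  assumes "x k \<noteq> hi" shows "x \<sqsubset> extend (prefix_of x k) hi"
proof -
  have "extend (prefix_of x k) hi k \<noteq> x k" using assms by (simp add: extend_prefix_of)
  then have "x \<noteq> extend (prefix_of x k) hi" by metis
  then show ?thesis using prefix_cylinder by blast
qed

text \<open>The right ends of the cylinders around \<open>x\<close> lie strictly above
  \<open>x\<close> and eventually drop below any \<open>y\<close> above it.\<close>

lemma no_successor_if_never_hi:
  assumes "\<And>k. x k \<noteq> hi" "x \<sqsubset> y"
  shows "\<exists>z. x \<sqsubset> z \<and> z \<sqsubset> y"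
proof -
  obtain n where "\<And>k. k \<ge> n \<Longrightarrow> extend (prefix_of x k) hi \<sqsubset> y"
    by (rule eventually_hi_below[OF assms(2)]) (rule that)
  then show ?thesis using lt_extend_hi[of x n, OF assms(1)] by blast
qed

text \<open>The ends of the cylinders around \<open>b\<close> converge to \<open>b\<close> from both
  sides; if \<open>b\<close> is the minimum or the maximum, the ends on that side all equal
  \<open>b\<close>.\<close>

lemma open_contains_cylinders:
  assumes U: "openin X U" "b \<in> U"
  obtains n where "\<And>k. k \<ge> n \<Longrightarrow> extend (prefix_of b k) lo \<in> U \<and> extend (prefix_of b k) hi \<in> U"
proof -
  have "\<exists>n. \<forall>k\<ge>n. extend (prefix_of b k) lo \<in> U"
  proof (cases "\<exists>c. c \<sqsubset> b")
    case True
    then obtain a where a: "a \<sqsubset> b" "\<forall>y. a \<sqsubset> y \<and> y \<sqsubseteq> b \<longrightarrow> y \<in> U"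
      using open_left_interval[OF U] by blast
    obtain n where "\<And>k. k \<ge> n \<Longrightarrow> a \<sqsubset> extend (prefix_of b k) lo"
      by (rule eventually_lo_above[OF a(1)]) (rule that)
    then have "extend (prefix_of b k) lo \<in> U" if "k \<ge> n" for k
      using a(2) prefix_cylinder(1)[of b k] that by blast
    then show ?thesis by blast
  next
    case False
    then have "extend (prefix_of b k) lo = b" for k
      using prefix_cylinder(1)[of b k] by blast
    then show ?thesis using U by simp
  qed
  moreover have "\<exists>n. \<forall>k\<ge>n. extend (prefix_of b k) hi \<in> U"
  proof (cases "\<exists>c. b \<sqsubset> c")
    case True
    then obtain a where a: "b \<sqsubset> a" "\<forall>y. y \<sqsubset> a \<and> b \<sqsubseteq> y \<longrightarrow> y \<in> U"
      using open_right_interval[OF U] by blast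
    obtain n where "\<And>k. k \<ge> n \<Longrightarrow> extend (prefix_of b k) hi \<sqsubset> a"
      by (rule eventually_hi_below[OF a(1)]) (rule that)
    then have "extend (prefix_of b k) hi \<in> U" if "k \<ge> n" for k
      using a(2) prefix_cylinder(2)[of b k] that by blast
    then show ?thesis by blast
  next
    case False
    then have "b = extend (prefix_of b k) hi" for k
      using prefix_cylinder(2)[of b k] by blast
    then have "extend (prefix_of b k) hi = b" for k by simp
    then show ?thesis using U by simp
  qed
  ultimately obtain n m where "\<And>k. k \<ge> n \<Longrightarrow> extend (prefix_of b k) lo \<in> U"
      "\<And>k. k \<ge> m \<Longrightarrow> extend (prefix_of b k) hi \<in> U" by blast
  then show ?thesis using that[of "max n m"] by simp
qed

text \<open>A cylinder with large oscillation whose left end is near \<open>x\<close> must contain the right end \<open>b\<close> of a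
  neighbourhood of \<open>x\<close>, and by continuity at \<open>b\<close> only finitely many cylinders around \<open>b\<close> oscillate.\<close>

lemma finite_large_oscillation:
  assumes f: "f \<in> Cfun X" and \<epsilon>: "\<epsilon> > 0"
  shows "finite {s. \<bar>f (extend s hi) - f (extend s lo)\<bar> \<ge> \<epsilon>}"
proof -
  define B where "B = {s. \<bar>f (extend s hi) - f (extend s lo)\<bar> \<ge> \<epsilon>}"
  define V where "V b = {y \<in> topspace X. f y \<in> ball (f b) (\<epsilon>/2)}" for b
  have V: "openin X (V b)" "b \<in> V b" for b
    using f openin_continuous_map_preimage[of X euclideanreal f "ball (f b) (\<epsilon>/2)"] \<epsilon>
    by (auto simp: Cfun_def V_def topspace_order)
  have osc: "\<not> (extend s lo \<in> V b \<and> extend s hi \<in> V b)" if "s \<in> B" for s b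
  proof
    assume "extend s lo \<in> V b \<and> extend s hi \<in> V b"
    then have "\<bar>f b - f (extend s lo)\<bar> < \<epsilon>/2" "\<bar>f b - f (extend s hi)\<bar> < \<epsilon>/2"
      unfolding V_def by (simp_all add: dist_real_def)
    moreover have "\<bar>f (extend s hi) - f (extend s lo)\<bar> \<ge> \<epsilon>" using that unfolding B_def by simp
    ultimately show False by linarith
  qed
  have fin_branch: "finite {s \<in> B. b \<in> cylinder s}" for b
  proof -
    obtain n where n: "\<And>k. k \<ge> n \<Longrightarrow>
        extend (prefix_of b k) lo \<in> V b \<and> extend (prefix_of b k) hi \<in> V b"
      by (rule open_contains_cylinders[OF V]) (rule that)
    have "{s \<in> B. b \<in> cylinder s} \<subseteq> prefix_of b ` {..<n}"
    proof
      fix s assume s: "s \<in> {s \<in> B. b \<in> cylinder s}"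
      then have "s = prefix_of b (length s)" by (simp add: in_cylinder_prefix_of)
      moreover have "length s < n"
        using s osc[of s b] n[of "length s"] calculation by (metis (no_types, lifting) mem_Collect_eq not_less)
      ultimately show "s \<in> prefix_of b ` {..<n}" by blast
    qed
    then show ?thesis by (rule finite_subset) simp
  qed
  have left: "\<exists>N. openin X N \<and> x \<in> N \<and> (\<forall>y\<in>N. \<forall>z. y \<sqsubseteq> z \<and> z \<sqsubseteq> x \<longrightarrow> z \<in> V x)" for x
  proof (cases "\<exists>c. c \<sqsubset> x")
    case True
    then obtain a where a: "a \<sqsubset> x" "\<forall>y. a \<sqsubset> y \<and> y \<sqsubseteq> x \<longrightarrow> y \<in> V x"
      using open_left_interval[OF V] by blast
    have "openin X {y \<in> UNIV. a \<sqsubset> y}" by (rule openin_above) simp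
    moreover have "\<forall>y\<in>{y \<in> UNIV. a \<sqsubset> y}. \<forall>z. y \<sqsubseteq> z \<and> z \<sqsubseteq> x \<longrightarrow> z \<in> V x"
      using a(2) lt_le_trans[of a] by blast
    ultimately show ?thesis using a(1) by (intro exI[of _ "{y \<in> UNIV. a \<sqsubset> y}"]) blast
  next
    case False
    then have "z = x" if "z \<sqsubseteq> x" for z using that by blast
    then show ?thesis using V by (intro exI[of _ "V x"]) blast
  qed
  \<comment> \<open>To the right of \<open>x\<close>, values can leave \<open>V x\<close> only from
    \<open>b\<close> on, and \<open>N\<close> ends before \<open>b\<close>. If \<open>x\<close> is
    the maximum, the condition is vacuous.\<close>
  have right: "\<exists>N b. openin X N \<and> x \<in> N \<and>
      (\<forall>y\<in>N. \<forall>z. x \<sqsubseteq> z \<and> z \<notin> V x \<longrightarrow> y \<sqsubseteq> b \<and> b \<sqsubseteq> z)" for x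
  proof (cases "\<exists>c. x \<sqsubset> c")
    case True
    then obtain b where b: "x \<sqsubset> b" "\<forall>y. y \<sqsubset> b \<and> x \<sqsubseteq> y \<longrightarrow> y \<in> V x"
      using open_right_interval[OF V] by blast
    have "openin X {y \<in> UNIV. y \<sqsubset> b}" by (rule openin_below) simp
    moreover have "b \<sqsubseteq> z" if "x \<sqsubseteq> z" "z \<notin> V x" for z
      using that b(2) le_total[of b z] by blast
    ultimately show ?thesis using b(1)
      by (intro exI[of _ "{y \<in> UNIV. y \<sqsubset> b}"] exI[of _ b]) blast
  next
    case False
    then have "z = x" if "x \<sqsubseteq> z" for z using that by blast
    then show ?thesis using V by (intro exI[of _ "V x"]) blast
  qed
  have "\<exists>N. openin X N \<and> x \<in> N \<and> finite {s \<in> B. extend s lo \<in> N}" for x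
  proof -
    obtain L where L: "openin X L" "x \<in> L" "\<forall>y\<in>L. \<forall>z. y \<sqsubseteq> z \<and> z \<sqsubseteq> x \<longrightarrow> z \<in> V x"
      using left by blast
    obtain N b where N: "openin X N" "x \<in> N"
        "\<forall>y\<in>N. \<forall>z. x \<sqsubseteq> z \<and> z \<notin> V x \<longrightarrow> y \<sqsubseteq> b \<and> b \<sqsubseteq> z"
      using right by blast
    let ?N = "V x \<inter> (L \<inter> N)"
    have "openin X ?N" by (intro openin_Int V L N)
    moreover have "x \<in> ?N" using V L N by simp
    moreover have "finite {s \<in> B. extend s lo \<in> ?N}"
    proof (rule finite_subset[OF _ fin_branch])
      show "{s \<in> B. extend s lo \<in> ?N} \<subseteq> {s \<in> B. b \<in> cylinder s}"
      proof
        fix s assume s: "s \<in> {s \<in> B. extend s lo \<in> ?N}"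
        \<comment> \<open>Left of \<open>x\<close> the whole segment stays in \<open>V x\<close>, so
          a right end outside \<open>V x\<close> lies beyond \<open>x\<close> and hence not before
          \<open>b\<close>, whereas the left end is not after \<open>b\<close>.\<close>
        then have hV: "extend s hi \<notin> V x" using osc by blast
        then have "\<not> extend s hi \<sqsubseteq> x" using L(3) s extend_lo_le_hi by blast
        then have "x \<sqsubseteq> extend s hi" using le_total[of "extend s hi" x] by blast
        then have "b \<in> cylinder s" using N(3) hV s unfolding cylinder_iff by blast
        then show "s \<in> {s \<in> B. b \<in> cylinder s}" using s by blast
      qed
    qed
    ultimately show ?thesis by blast
  qed
  then have "\<forall>x. \<exists>N. openin X N \<and> x \<in> N \<and> finite {s \<in> B. extend s lo \<in> N}" by (rule allI)
  from choice[OF this] obtain N where N: "\<And>x. openin X (N x)" "\<And>x. x \<in> N x"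
      "\<And>x. finite {s \<in> B. extend s lo \<in> N x}" by blast
  have "\<exists>\<F>. finite \<F> \<and> \<F> \<subseteq> range N \<and> topspace X \<subseteq> \<Union>\<F>"
    using compact_space_order[unfolded compact_space_alt] N(1,2)
    by (elim allE[of _ "range N"]) auto
  then obtain \<F> where \<F>: "finite \<F>" "\<F> \<subseteq> range N" "topspace X \<subseteq> \<Union>\<F>" by blast
  obtain F where "finite F" "\<F> = N ` F"
    using finite_subset_image[OF \<F>(1,2)] by blast
  then have F: "finite F" "topspace X \<subseteq> \<Union>(N ` F)" using \<F>(3) by simp_all
  have "B \<subseteq> (\<Union>x\<in>F. {s \<in> B. extend s lo \<in> N x})"
    using F(2) unfolding topspace_order by blast
  moreover have "finite (\<Union>x\<in>F. {s \<in> B. extend s lo \<in> N x})"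
    using F(1) N(3) by (rule finite_UN_I)
  ultimately have "finite B" by (rule finite_subset)
  then show ?thesis by (simp add: B_def)
qed

end

section \<open>Ladders\<close>

lemma c0_nat_iff: "a \<in> c0 (UNIV :: nat set) \<longleftrightarrow> a \<longlonglongrightarrow> 0"
proof
  assume a: "a \<in> c0 UNIV"
  show "a \<longlonglongrightarrow> 0"
  proof (rule LIMSEQ_I)
    fix \<epsilon> :: real assume "\<epsilon> > 0"
    then have "finite {i. \<bar>a i\<bar> \<ge> \<epsilon>}" using a by (simp add: c0_def)
    then obtain n where "\<And>i. \<bar>a i\<bar> \<ge> \<epsilon> \<Longrightarrow> i < n" by (auto simp: finite_nat_set_iff_bounded)
    then have "\<bar>a i\<bar> < \<epsilon>" if "i \<ge> n" for i using that by (meson leD leI)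
    then show "\<exists>n. \<forall>i\<ge>n. norm (a i - 0) < \<epsilon>" by auto
  qed
next
  assume a: "a \<longlonglongrightarrow> 0"
  have "finite {i. \<bar>a i\<bar> \<ge> \<epsilon>}" if \<epsilon>: "\<epsilon> > 0" for \<epsilon>
  proof -
    obtain n where n: "\<forall>i\<ge>n. \<bar>a i\<bar> < \<epsilon>" using LIMSEQ_D[OF a \<epsilon>] by auto
    have "{i. \<bar>a i\<bar> \<ge> \<epsilon>} \<subseteq> {..<n}"
    proof
      fix i assume "i \<in> {i. \<bar>a i\<bar> \<ge> \<epsilon>}"
      then show "i \<in> {..<n}" using n by (cases "n \<le> i") auto
    qed
    then show ?thesis by (rule finite_subset) simp
  qed
  then show "a \<in> c0 UNIV" by (simp add: c0_def)
qed

text \<open>Any \<open>k\<close> beyond the first differences of all pairs will do. The cylinders of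
  length \<open>k\<close> around the points of \<open>F\<close> are then disjoint.\<close>

lemma prefix_of_inj_on:
  assumes "finite F"
  obtains k where "inj_on (\<lambda>x. prefix_of x k) F"
proof -
  define d where "d = (\<lambda>(x, y). LEAST n. x n \<noteq> (y :: nat \<Rightarrow> 'a) n)"
  have "finite (d ` (F \<times> F))" using assms by simp
  then obtain k where k: "\<forall>i\<in>d ` (F \<times> F). i < k" by (auto simp: finite_nat_set_iff_bounded)
  have "inj_on (\<lambda>x. prefix_of x k) F"
  proof (rule inj_onI, rule ccontr)
    fix x y assume xy: "x \<in> F" "y \<in> F" "prefix_of x k = prefix_of y k" "x \<noteq> y"
    then have "\<exists>n. x n \<noteq> y n" by auto
    then have "x (d (x, y)) \<noteq> y (d (x, y))" unfolding d_def by (simp, rule LeastI_ex)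
    moreover have "d (x, y) < k" using k xy by blast
    ultimately show False using xy(3) by (simp add: prefix_of_eq_iff)
  qed
  then show ?thesis by (rule that)
qed

text \<open>\<open>below \<alpha>\<close> stands for the predecessors of \<open>\<alpha>\<close> in
  a well-order of \<open>W\<close> with countable initial segments; this order need not be related
  to the order of the type.\<close>

locale lex_ladder = lex_line lo hi for lo hi :: "'a::linorder" +
  fixes W :: "'a set" and below :: "'a \<Rightarrow> 'a set" and lad :: "'a \<Rightarrow> nat \<Rightarrow> 'a"
  assumes W_hi: "hi \<notin> W" and W_uncountable: "uncountable W"
    and below_subset: "\<alpha> \<in> W \<Longrightarrow> below \<alpha> \<subseteq> W"
    and below_countable: "\<alpha> \<in> W \<Longrightarrow> countable (below \<alpha>)"
    and below_least: "Z \<subseteq> W \<Longrightarrow> Z \<noteq> {} \<Longrightarrow> \<exists>m\<in>Z. below m \<inter> Z = {}"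
    and below_irrefl: "\<alpha> \<notin> below \<alpha>"
    and below_total: "\<alpha> \<in> W \<Longrightarrow> \<beta> \<in> W \<Longrightarrow> \<alpha> \<noteq> \<beta> \<Longrightarrow> \<alpha> \<in> below \<beta> \<or> \<beta> \<in> below \<alpha>"
    and range_lad: "\<alpha> \<in> W \<Longrightarrow> below \<alpha> \<noteq> {} \<Longrightarrow> range (lad \<alpha>) = below \<alpha>"
begin

definition W0 :: "'a set" where "W0 = {\<alpha> \<in> W. below \<alpha> \<noteq> {}}"
definition A :: "(nat \<Rightarrow> 'a) set" where "A = lad ` W0"

lemma range_lad': "\<alpha> \<in> W0 \<Longrightarrow> range (lad \<alpha>) = below \<alpha>"
  using range_lad by (simp add: W0_def)

lemma A_neq_hi: "t \<in> A \<Longrightarrow> t k \<noteq> hi"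
proof -
  assume "t \<in> A"
  then obtain \<alpha> where "\<alpha> \<in> W0" "t = lad \<alpha>" unfolding A_def by blast
  then have "t k \<in> W" using range_lad' below_subset unfolding W0_def by blast
  then show ?thesis using W_hi by blast
qed

lemma inj_lad: "inj_on lad W0"
proof (rule inj_onI, rule ccontr)
  fix \<alpha> \<beta> assume *: "\<alpha> \<in> W0" "\<beta> \<in> W0" "lad \<alpha> = lad \<beta>" "\<alpha> \<noteq> \<beta>"
  then have "below \<alpha> = below \<beta>" using range_lad' by metis
  then show False using below_total[of \<alpha> \<beta>] below_irrefl * unfolding W0_def by blast
qed

text \<open>Some \<open>\<beta>\<close> of \<open>W\<close> lies outside \<open>T\<close>. A ladder
  inside \<open>T\<close> omits \<open>\<beta>\<close>, so its index is \<open>\<beta>\<close> or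
  one of the countably many predecessors of \<open>\<beta>\<close>.\<close>

lemma countable_ladders:
  assumes "countable T"
  shows "countable {t \<in> A. range t \<subseteq> T}"
proof -
  have "\<not> W \<subseteq> T" using W_uncountable assms countable_subset by blast
  then obtain \<beta> where \<beta>: "\<beta> \<in> W" "\<beta> \<notin> T" by blast
  have "{t \<in> A. range t \<subseteq> T} \<subseteq> lad ` (insert \<beta> (below \<beta>))"
  proof
    fix t assume "t \<in> {t \<in> A. range t \<subseteq> T}"
    then obtain \<alpha> where \<alpha>: "\<alpha> \<in> W0" "t = lad \<alpha>" "below \<alpha> \<subseteq> T"
      unfolding A_def using range_lad' by auto
    then have "\<beta> \<notin> below \<alpha>" "\<alpha> \<in> W" using \<beta> unfolding W0_def by auto
    then have "\<alpha> \<in> insert \<beta> (below \<beta>)" using below_total \<beta>(1) by blast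
    then show "t \<in> lad ` (insert \<beta> (below \<beta>))" using \<alpha>(2) by blast
  qed
  moreover have "countable (lad ` (insert \<beta> (below \<beta>)))"
    using below_countable[OF \<beta>(1)] by simp
  ultimately show ?thesis by (rule countable_subset)
qed

text \<open>A pressing-down argument: close a countable set under \<open>\<rho>\<close>-preimages; the least element
  outside the closure would have to belong to it.\<close>

lemma pressing_down:
  fixes \<rho> :: "'a \<Rightarrow> 'a list"
  assumes regr: "\<And>\<alpha>. \<alpha> \<in> W0 \<Longrightarrow> set (\<rho> \<alpha>) \<subseteq> below \<alpha>"
  shows "\<exists>s. uncountable {\<alpha> \<in> W0. \<rho> \<alpha> = s}"
proof (rule ccontr)
  assume "\<not> ?thesis"
  then have fib: "countable {\<alpha> \<in> W0. \<rho> \<alpha> = s}" for s by blast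
  define step where "step Z = Z \<union> {\<alpha> \<in> W0. \<rho> \<alpha> \<in> lists Z}" for Z
  \<comment> \<open>Starting from the points without predecessors ensures that a point never reached
    lies in \<open>W0\<close>, where \<open>\<rho>\<close> is regressive.\<close>
  define C where "C n = (step ^^ n) {\<alpha> \<in> W. below \<alpha> = {}}" for n
  have step: "countable (step Z)" if "countable Z" for Z
  proof -
    have "{\<alpha> \<in> W0. \<rho> \<alpha> \<in> lists Z} = (\<Union>s\<in>lists Z. {\<alpha> \<in> W0. \<rho> \<alpha> = s})" by blast
    moreover have "countable (\<Union>s\<in>lists Z. {\<alpha> \<in> W0. \<rho> \<alpha> = s})"
      using that fib by (intro countable_UN) (auto simp: countable_lists)
    ultimately show ?thesis using that by (simp add: step_def)
  qed
  have "countable {\<alpha> \<in> W. below \<alpha> = {}}"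
  proof (cases "{\<alpha> \<in> W. below \<alpha> = {}} = {}")
    case False
    then obtain \<alpha> where "\<alpha> \<in> W" "below \<alpha> = {}" by blast
    then have "{\<alpha> \<in> W. below \<alpha> = {}} \<subseteq> {\<alpha>}" using below_total by blast
    then show ?thesis by (rule countable_subset) simp
  qed (metis countable_empty)
  then have cC: "countable (C n)" for n
    by (induction n) (simp_all add: C_def step)
  have mono: "C n \<subseteq> C m" if "n \<le> m" for n m
    using that by (rule lift_Suc_mono_le[rotated]) (auto simp: C_def step_def)
  have "\<not> W \<subseteq> (\<Union>n. C n)"
    using W_uncountable cC countable_subset[of W "\<Union>n. C n"] by auto
  then obtain \<beta> where \<beta>: "\<beta> \<in> W - (\<Union>n. C n)" "below \<beta> \<inter> (W - (\<Union>n. C n)) = {}"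
    using below_least[of "W - (\<Union>n. C n)"] by blast
  have "\<beta> \<notin> C 0" using \<beta> by blast
  then have b0: "\<beta> \<in> W0" using \<beta>(1) unfolding W0_def C_def by auto
  have "set (\<rho> \<beta>) \<subseteq> (\<Union>n. C n)"
    using regr[OF b0] below_subset[of \<beta>] \<beta> by blast
  \<comment> \<open>A list has finitely many entries, so they all appear at one stage, and the next
    stage captures \<open>\<beta>\<close>.\<close>
  moreover have "finite L \<Longrightarrow> L \<subseteq> (\<Union>n. C n) \<Longrightarrow> \<exists>n. L \<subseteq> C n" for L
  proof (induction L rule: finite_induct)
    case (insert x L)
    then obtain n m where "L \<subseteq> C n" "x \<in> C m" by auto
    then have "insert x L \<subseteq> C (max n m)"
      using mono[of n "max n m"] mono[of m "max n m"] by auto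
    then show ?case by blast
  qed simp
  ultimately obtain n where "set (\<rho> \<beta>) \<subseteq> C n" by blast
  then have "\<beta> \<in> C (Suc n)" using b0 by (auto simp: C_def step_def)
  then show False using \<beta>(1) by blast
qed

sublocale split_line lex_omega A
  by unfold_locales (use A_neq_hi no_successor_if_never_hi in blast)

section \<open>Steps localised over a cylinder\<close>

definition cut :: "(nat \<Rightarrow> 'a) \<Rightarrow> nat \<Rightarrow> (nat \<Rightarrow> 'a) \<Rightarrow> real" where
  "cut t k = (SOME h. h \<in> Cfun X \<and> (\<forall>P. \<bar>chi t P - pull h P\<bar> \<le> 1 \<and>
     (chi t P - pull h P \<noteq> 0 \<longrightarrow> P \<in> Kt \<and> base P \<in> cylinder (prefix_of t k))))"

text \<open>It differs from the step \<open>chi t\<close> by a pulled-back function, so it has the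
  same unit jump at \<open>t\<close>, but it vanishes off the cylinder of the first \<open>k\<close>
  entries.\<close>

definition bump :: "(nat \<Rightarrow> 'a) \<Rightarrow> nat \<Rightarrow> ((nat \<Rightarrow> 'a) \<Rightarrow> bool) \<Rightarrow> real" where
  "bump t k = (\<lambda>P. chi t P - pull (cut t k) P)"

text \<open>Since \<open>t k\<close> is not \<open>hi\<close>, the right end of the cylinder lies
  strictly above \<open>t\<close>, and a tent from \<open>t\<close> to this end fits inside the
  cylinder.\<close>

lemma cut_bump:
  assumes t: "t \<in> A"
  shows "cut t k \<in> Cfun X" "\<bar>bump t k P\<bar> \<le> 1"
    "bump t k P \<noteq> 0 \<Longrightarrow> P \<in> Kt \<and> base P \<in> cylinder (prefix_of t k)"
proof -
  have "t \<sqsubset> extend (prefix_of t k) hi" using lt_extend_hi A_neq_hi[OF t] by blast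
  then obtain h where h: "h \<in> Cfun X" "\<And>P. \<bar>chi t P - pull h P\<bar> \<le> 1"
    "\<And>P. chi t P - pull h P \<noteq> 0 \<Longrightarrow>
        P \<in> Kt \<and> t \<sqsubseteq> base P \<and> base P \<sqsubset> extend (prefix_of t k) hi"
    by (rule tent[OF t]) (rule that)
  have "P \<in> Kt \<and> base P \<in> cylinder (prefix_of t k)" if "chi t P - pull h P \<noteq> 0" for P
    using h(3)[OF that] le_trans[OF prefix_cylinder(1)[of t k]] unfolding cylinder_iff by blast
  then have "\<exists>h. h \<in> Cfun X \<and> (\<forall>P. \<bar>chi t P - pull h P\<bar> \<le> 1 \<and>
     (chi t P - pull h P \<noteq> 0 \<longrightarrow> P \<in> Kt \<and> base P \<in> cylinder (prefix_of t k)))"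
    using h(1,2) by blast
  from someI_ex[OF this, folded cut_def]
  show "cut t k \<in> Cfun X" "\<bar>bump t k P\<bar> \<le> 1"
    "bump t k P \<noteq> 0 \<Longrightarrow> P \<in> Kt \<and> base P \<in> cylinder (prefix_of t k)"
    unfolding bump_def by blast+
qed

lemma bump_in_Cfun: "t \<in> A \<Longrightarrow> bump t k \<in> Cfun T.X"
  unfolding bump_def
  by (intro fun_subspaceD(4)[OF fun_subspace_Cfun] chi_in_Cfun pull_in_Cfun cut_bump)

text \<open>Distinct prefixes of the same length have disjoint cylinders, so at each point at most
  one bump is nonzero.\<close>

lemma abs_sum_bump_le:
  assumes F: "finite F" "F \<subseteq> A" "inj_on (\<lambda>t. prefix_of t k) F"
    and c: "c \<ge> 0" "\<And>t. t \<in> F \<Longrightarrow> \<bar>a t\<bar> \<le> c"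
  shows "\<bar>\<Sum>t\<in>F. a t * bump t k P\<bar> \<le> c"
proof (rule abs_sum_disjoint_le[OF F(1) c(1)])
  fix t assume t: "t \<in> F"
  then have "\<bar>bump t k P\<bar> \<le> 1" using cut_bump(2) F(2) by blast
  then show "\<bar>a t * bump t k P\<bar> \<le> c"
    using c t mult_mono[of "\<bar>a t\<bar>" c "\<bar>bump t k P\<bar>" 1] by (simp add: abs_mult)
next
  fix t t' assume tt: "t \<in> F" "t' \<in> F" "a t * bump t k P \<noteq> 0" "a t' * bump t' k P \<noteq> 0"
  then have "base P \<in> cylinder (prefix_of t k)" "base P \<in> cylinder (prefix_of t' k)"
    using cut_bump(3) F(2) by (metis mult_eq_0_iff subset_iff)+
  then have "prefix_of t k = prefix_of t' k" by (simp add: in_cylinder_prefix_of)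
  then show "t = t'" using F(3) tt unfolding inj_on_def by blast
qed

lemma compact_Kt: "compact_space T.X" "topspace T.X \<noteq> {}"
  using T.compact_space_order T.topspace_order lower_in_Kt by auto

lemma fun_subspace_pull: "fun_subspace (pull ` Cfun X)"
proof -
  have "(\<lambda>P. 0) = pull (\<lambda>x. 0)" "(\<lambda>P. pull f P + pull g P) = pull (\<lambda>x. f x + g x)"
    "(\<lambda>P. c * pull f P) = pull (\<lambda>x. c * f x)" for f g c
    by (auto simp: pull_def fun_eq_iff)
  then show ?thesis
    using fun_subspaceD[OF fun_subspace_Cfun[of X]] unfolding fun_subspace_def by (auto intro!: imageI)
qed

lemma pull_subset_Cfun: "pull ` Cfun X \<subseteq> Cfun T.X"
  using pull_in_Cfun by blast

end

section \<open>Extension of operators into \<open>c\<^sub>0(\<nat>)\<close>\<close>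

context lex_ladder
begin

definition jump :: "(((nat \<Rightarrow> 'a) \<Rightarrow> bool) \<Rightarrow> real) \<Rightarrow> (nat \<Rightarrow> 'a) \<Rightarrow> real" where
  "jump f t = f (upper t) - f (lower t)"

lemma jump_pull: "t \<in> A \<Longrightarrow> jump (pull g) t = 0"
  by (simp add: jump_def)

lemma jump_chi: "t \<in> A \<Longrightarrow> t' \<in> A \<Longrightarrow> jump (chi t) t' = (if t = t' then 1 else 0)"
  using le_refl le_antisym by (auto simp: jump_def)

text \<open>The jumps of \<open>f\<close> at the points of \<open>F\<close> are removed. The map is
  linear and fixes pullbacks, so composing a functional with it preserves what the functional
  extends.\<close>

definition smooth :: "nat \<Rightarrow> (nat \<Rightarrow> 'a) set \<Rightarrow> (((nat \<Rightarrow> 'a) \<Rightarrow> bool) \<Rightarrow> real) \<Rightarrow> ((nat \<Rightarrow> 'a) \<Rightarrow> bool) \<Rightarrow> real" where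
  "smooth k F f = (\<lambda>P. f P - (\<Sum>t\<in>F. jump f t * bump t k P))"

lemma smooth_add: "smooth k F (\<lambda>P. f P + g P) = (\<lambda>P. smooth k F f P + smooth k F g P)"
  unfolding smooth_def jump_def by (simp add: fun_eq_iff algebra_simps sum.distrib sum_subtractf)

lemma smooth_scale: "smooth k F (\<lambda>P. c * f P) = (\<lambda>P. c * smooth k F f P)"
  unfolding smooth_def jump_def by (simp add: fun_eq_iff algebra_simps sum_distrib_left sum_subtractf)

lemma smooth_pull: "F \<subseteq> A \<Longrightarrow> smooth k F (pull g) = pull g"
  unfolding smooth_def using jump_pull by (simp add: fun_eq_iff subset_iff)

lemma smooth_chi:
  assumes "finite F" "F \<subseteq> A" "t \<in> A"
  shows "smooth k F (chi t) = (if t \<in> F then pull (cut t k) else chi t)"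
proof -
  have "(\<Sum>t'\<in>F. jump (chi t) t' * bump t' k P) = (if t \<in> F then bump t k P else 0)" for P
  proof -
    have "(\<Sum>t'\<in>F. jump (chi t) t' * bump t' k P) = (\<Sum>t'\<in>F. if t = t' then bump t' k P else 0)"
      using assms jump_chi by (intro sum.cong) auto
    then show ?thesis using assms(1) by simp
  qed
  then show ?thesis by (simp add: smooth_def bump_def fun_eq_iff)
qed

lemma smooth_in_Cfun:
  assumes "finite F" "F \<subseteq> A" "f \<in> Cfun T.X"
  shows "smooth k F f \<in> Cfun T.X"
  unfolding smooth_def
  by (intro fun_subspaceD(4)[OF fun_subspace_Cfun] fun_subspace_sum fun_subspace_Cfun
      fun_subspaceD(3)[OF fun_subspace_Cfun] bump_in_Cfun) (use assms in auto)

lemma smooth_norm: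
  assumes F: "finite F" "F \<subseteq> A" "inj_on (\<lambda>t. prefix_of t k) F" and f: "f \<in> Cfun T.X"
  shows "sup_norm_on (topspace T.X) (smooth k F f) \<le> 3 * sup_norm_on (topspace T.X) f"
proof (rule sup_norm_le[OF compact_Kt])
  fix P
  let ?n = "sup_norm_on (topspace T.X) f"
  have f': "\<bar>f Q\<bar> \<le> ?n" for Q by (rule abs_le_sup_norm[OF compact_Kt f])
  \<comment> \<open>A jump is at most twice the norm; together with \<open>f\<close> itself this
    gives the factor 3, whatever the size of \<open>F\<close>.\<close>
  have "\<bar>jump f t\<bar> \<le> 2 * ?n" for t
    using f'[of "upper t"] f'[of "lower t"] unfolding jump_def by linarith
  then have "\<bar>\<Sum>t\<in>F. jump f t * bump t k P\<bar> \<le> 2 * ?n"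
    using sup_norm_nonneg[OF compact_Kt f] by (intro abs_sum_bump_le[OF F]) auto
  then show "\<bar>smooth k F f P\<bar> \<le> 3 * ?n" using f'[of P] unfolding smooth_def by linarith
qed

lemma extend_functional:
  assumes lin: "fun_linear_on (pull ` Cfun X) l"
    and bd: "\<And>f. f \<in> pull ` Cfun X \<Longrightarrow> l f \<le> M * sup_norm_on (topspace T.X) f"
    and M: "M \<ge> 0"
  shows "\<exists>\<nu>. fun_linear_on (Cfun T.X) \<nu> \<and> (\<forall>f\<in>pull ` Cfun X. \<nu> f = l f) \<and>
    (\<forall>f\<in>Cfun T.X. \<bar>\<nu> f\<bar> \<le> M * sup_norm_on (topspace T.X) f)"
proof -
  let ?n = "sup_norm_on (topspace T.X)"
  note abs_le = abs_le_sup_norm[OF compact_Kt]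
  have add: "M * ?n (\<lambda>x. f x + g x) \<le> M * ?n f + M * ?n g" if "f \<in> Cfun T.X" "g \<in> Cfun T.X" for f g
  proof -
    have "?n (\<lambda>x. f x + g x) \<le> ?n f + ?n g"
    proof (rule sup_norm_le[OF compact_Kt])
      fix x show "\<bar>f x + g x\<bar> \<le> ?n f + ?n g"
        using abs_le[OF that(1), of x] abs_le[OF that(2), of x] by linarith
    qed
    then show ?thesis using M by (simp add: mult_left_mono flip: distrib_left)
  qed
  have scale: "M * ?n (\<lambda>x. c * f x) = c * (M * ?n f)" if "f \<in> Cfun T.X" "c \<ge> 0" for c f
    using sup_norm_scale[OF compact_Kt that] by simp
  obtain \<nu> where \<nu>: "fun_linear_on (Cfun T.X) \<nu>" "\<And>f. f \<in> pull ` Cfun X \<Longrightarrow> \<nu> f = l f"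
    "\<And>f. f \<in> Cfun T.X \<Longrightarrow> \<nu> f \<le> M * ?n f"
    by (rule Hahn_Banach_fun[OF fun_subspace_Cfun[of T.X] fun_subspace_pull pull_subset_Cfun lin bd add scale])
       (assumption+, rule that)
  have "\<bar>\<nu> f\<bar> \<le> M * ?n f" if f: "f \<in> Cfun T.X" for f
  proof -
    have "(\<lambda>x. -1 * f x) \<in> Cfun T.X" by (rule fun_subspaceD(3)[OF fun_subspace_Cfun f])
    moreover have "?n (\<lambda>x. -1 * f x) = ?n f" by (simp add: sup_norm_on_def)
    ultimately have "- \<nu> f \<le> M * ?n f"
      using \<nu>(3)[of "\<lambda>x. -1 * f x"] fun_linear_onD(2)[OF \<nu>(1) f, of "-1"] by simp
    then show ?thesis using \<nu>(3)[OF f] by linarith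
  qed
  then show ?thesis using \<nu> by blast
qed

text \<open>Coordinate \<open>n\<close> of the extension is a Hahn-Banach extension
  \<open>\<nu> n\<close> composed with smoothing at the finite set \<open>F (level n)\<close>. The
  uniform bound reduces convergence to 0 to pullbacks and steps, which span a dense space.\<close>

theorem c0_extension_nat: "c0_extension_property T.X X base (UNIV :: nat set)"
  unfolding c0_extension_property_def pullback_space_pull
proof (intro allI impI)
  fix T assume T: "bounded_linear_op_into_c0 T.X (pull ` Cfun X) (UNIV :: nat set) T"
  let ?V = "pull ` Cfun X" and ?n = "sup_norm_on (topspace T.X)"
  have Tc0: "T f \<in> c0 UNIV" if "f \<in> ?V" for f
    using T that unfolding bounded_linear_op_into_c0_def by blast
  have Tlim: "T f \<longlonglongrightarrow> 0" if "f \<in> ?V" for f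
    using Tc0[OF that] by (simp add: c0_nat_iff)
  have Tadd: "T (\<lambda>x. f x + g x) = (\<lambda>i. T f i + T g i)" if "f \<in> ?V" "g \<in> ?V" for f g
    using T that unfolding bounded_linear_op_into_c0_def by blast
  have Tscale: "T (\<lambda>x. c * f x) = (\<lambda>i. c * T f i)" if "f \<in> ?V" for c f
    using T that unfolding bounded_linear_op_into_c0_def by blast
  have "\<exists>M0. \<forall>f\<in>?V. sup_norm_on UNIV (T f) \<le> M0 * ?n f"
    using T unfolding bounded_linear_op_into_c0_def by (elim conjE)
  then obtain M0 where M0: "\<And>f. f \<in> ?V \<Longrightarrow> sup_norm_on UNIV (T f) \<le> M0 * ?n f" by blast
  define M where "M = \<bar>M0\<bar>"
  have M: "M \<ge> 0" by (simp add: M_def)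
  have "\<exists>\<nu>. fun_linear_on (Cfun T.X) \<nu> \<and> (\<forall>f\<in>?V. \<nu> f = T f n) \<and>
    (\<forall>f\<in>Cfun T.X. \<bar>\<nu> f\<bar> \<le> M * ?n f)" for n
  proof (rule extend_functional[OF _ _ M])
    show "fun_linear_on ?V (\<lambda>f. T f n)"
      unfolding fun_linear_on_def using Tadd Tscale by simp
    fix f assume f: "f \<in> ?V"
    have "\<bar>T f n\<bar> \<le> M0 * ?n f"
      using c0_abs_le_sup_norm[OF Tc0[OF f], of n] M0[OF f] by simp
    also have "\<dots> \<le> M * ?n f"
      using f sup_norm_nonneg[OF compact_Kt] pull_subset_Cfun by (intro mult_right_mono) (auto simp: M_def)
    finally show "T f n \<le> M * ?n f" by linarith
  qed
  then have "\<forall>n. \<exists>\<nu>. fun_linear_on (Cfun T.X) \<nu> \<and> (\<forall>f\<in>?V. \<nu> f = T f n) \<and>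
    (\<forall>f\<in>Cfun T.X. \<bar>\<nu> f\<bar> \<le> M * ?n f)" by (rule allI)
  from choice[OF this] obtain \<nu> where \<nu>: "\<And>n. fun_linear_on (Cfun T.X) (\<nu> n)"
    "\<And>n f. f \<in> ?V \<Longrightarrow> \<nu> n f = T f n" "\<And>n f. f \<in> Cfun T.X \<Longrightarrow> \<bar>\<nu> n f\<bar> \<le> M * ?n f"
    by blast
  text \<open>The bad cylinders are those that carry mass of some \<open>\<nu> n\<close>; a ladder all of whose cylinders are bad
    runs inside the countable set of their entries.\<close>
  define bad where "bad n k = {s \<in> {s. length s = k}. \<exists>u\<in>Cfun T.X. (\<forall>x. \<bar>u x\<bar> \<le> 1) \<and>
      (\<forall>x. u x \<noteq> 0 \<longrightarrow> x \<in> {P. base P \<in> cylinder s}) \<and> \<nu> n u \<noteq> 0}" for n k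
  have cbad: "countable (bad n k)" for n k
    unfolding bad_def
  proof (rule countable_disjoint_support[OF compact_Kt \<nu>(1)])
    show "\<nu> n f \<le> M * ?n f" if "f \<in> Cfun T.X" for f using \<nu>(3)[OF that, of n] by linarith
    show "s = s'" if "s \<in> {s. length s = k}" "s' \<in> {s. length s = k}"
      "P \<in> {P. base P \<in> cylinder s}" "P \<in> {P. base P \<in> cylinder s'}" for P s s'
      using that by (simp add: in_cylinder_prefix_of)
  qed
  have cT: "countable (\<Union>s\<in>(\<Union>n. \<Union>k. bad n k). set s)"
    by (intro countable_UN cbad) (auto intro: countable_finite)
  define A' where "A' = {t \<in> A. range t \<subseteq> (\<Union>s\<in>(\<Union>n. \<Union>k. bad n k). set s)}"
  have cA': "countable A'" unfolding A'_def by (rule countable_ladders[OF cT])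
  have good: "\<exists>k. \<forall>n. \<nu> n (bump t k) = 0" if t: "t \<in> A" "t \<notin> A'" for t
  proof (rule ccontr)
    assume neg: "\<nexists>k. \<forall>n. \<nu> n (bump t k) = 0"
    have "t i \<in> (\<Union>s\<in>(\<Union>n. \<Union>k. bad n k). set s)" for i
    proof -
      \<comment> \<open>Length \<open>Suc i\<close> makes the bad prefix contain the entry
        \<open>t i\<close>.\<close>
      obtain n where n: "\<nu> n (bump t (Suc i)) \<noteq> 0" using neg by blast
      have "prefix_of t (Suc i) \<in> bad n (Suc i)"
        unfolding bad_def mem_Collect_eq length_prefix_of
        using n cut_bump(2,3)[OF t(1)]
        by (intro conjI refl bexI[OF _ bump_in_Cfun[OF t(1), of "Suc i"]]) auto
      moreover have "t i \<in> set (prefix_of t (Suc i))" by (simp add: prefix_of_def)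
      ultimately show ?thesis by blast
    qed
    then show False using t unfolding A'_def by blast
  qed
  \<comment> \<open>Finite sets exhausting the exceptional ladders, so that at each stage a common
    prefix length separates them.\<close>
  define F where "F m = {t \<in> A'. to_nat_on A' t < m}" for m
  have F: "finite (F m)" "F m \<subseteq> A" for m
  proof -
    have "inj_on (to_nat_on A') (F m)" using inj_on_to_nat_on[OF cA'] by (rule inj_on_subset) (auto simp: F_def)
    moreover have "to_nat_on A' ` F m \<subseteq> {..<m}" by (auto simp: F_def)
    ultimately show "finite (F m)" by (metis finite_imageD finite_lessThan finite_subset)
    show "F m \<subseteq> A" by (auto simp: F_def A'_def)
  qed
  have "\<forall>m. \<exists>k. inj_on (\<lambda>t. prefix_of t k) (F m)"
  proof
    fix m show "\<exists>k. inj_on (\<lambda>t. prefix_of t k) (F m)"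
      by (rule prefix_of_inj_on[OF F(1)[of m]]) (rule exI)
  qed
  from choice[OF this] obtain kk where kk: "\<And>m. inj_on (\<lambda>t. prefix_of t (kk m)) (F m)" by blast
  \<comment> \<open>The sequence \<open>T\<close> assigns to each of these finitely many pullbacks
    tends to 0, so one \<open>N\<close> serves them all.\<close>
  have "\<exists>N. \<forall>n\<ge>N. \<forall>t\<in>F m. \<bar>T (pull (cut t (kk m))) n\<bar> < inverse (real (Suc m))" for m
  proof -
    have "\<forall>t\<in>F m. \<forall>\<^sub>F n in sequentially. \<bar>T (pull (cut t (kk m))) n\<bar> < inverse (real (Suc m))"
    proof
      fix t assume "t \<in> F m"
      then have "pull (cut t (kk m)) \<in> ?V" using F cut_bump(1) by blast
      from tendsto_rabs_zero[OF Tlim[OF this]]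
      show "\<forall>\<^sub>F n in sequentially. \<bar>T (pull (cut t (kk m))) n\<bar> < inverse (real (Suc m))"
        by (rule order_tendstoD(2)) simp
    qed
    then have "\<forall>\<^sub>F n in sequentially. \<forall>t\<in>F m. \<bar>T (pull (cut t (kk m))) n\<bar> < inverse (real (Suc m))"
      using F(1) by (simp add: eventually_ball_finite)
    then show ?thesis by (simp add: eventually_sequentially)
  qed
  then have "\<forall>m. \<exists>N. \<forall>n\<ge>N. \<forall>t\<in>F m. \<bar>T (pull (cut t (kk m))) n\<bar> < inverse (real (Suc m))"
    by (rule allI)
  from choice[OF this] obtain N where
    N: "\<And>m n t. n \<ge> N m \<Longrightarrow> t \<in> F m \<Longrightarrow> \<bar>T (pull (cut t (kk m))) n\<bar> < inverse (real (Suc m))" by blast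
  text \<open>The diagonal choice of how many jumps to remove from \<open>\<nu> n\<close>.\<close>
  define level where "level n = Max {m. m \<le> n \<and> (m = 0 \<or> N m \<le> n)}" for n
  have level_fin: "finite {m. m \<le> n \<and> (m = 0 \<or> N m \<le> n)}" for n by simp
  have level_in: "level n = 0 \<or> N (level n) \<le> n" for n
  proof -
    have "{m. m \<le> n \<and> (m = 0 \<or> N m \<le> n)} \<noteq> {}" by blast
    from Max_in[OF level_fin this] show ?thesis unfolding level_def by simp
  qed
  have level_ge: "m \<le> level n" if "m \<le> n" "N m \<le> n" for m n
    unfolding level_def using that by (intro Max_ge[OF level_fin]) simp
  have small: "\<bar>T (pull (cut t (kk (level n)))) n\<bar> < inverse (real (Suc (level n)))"
    if "t \<in> F (level n)" for t n
  proof -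
    have "level n \<noteq> 0" using that by (auto simp: F_def)
    then show ?thesis using N[OF _ that] level_in[of n] by simp
  qed
  define S where "S f n = \<nu> n (smooth (kk (level n)) (F (level n)) f)" for f n
  have S_bound: "\<bar>S f n\<bar> \<le> 3 * M * ?n f" if f: "f \<in> Cfun T.X" for f n
  proof -
    have "\<bar>S f n\<bar> \<le> M * ?n (smooth (kk (level n)) (F (level n)) f)"
      unfolding S_def by (rule \<nu>(3)[OF smooth_in_Cfun[OF F f]])
    also have "\<dots> \<le> M * (3 * ?n f)" by (rule mult_left_mono[OF smooth_norm[OF F kk f] M])
    finally show ?thesis by simp
  qed
  have S_add: "S (\<lambda>x. f x + g x) n = S f n + S g n" if "f \<in> Cfun T.X" "g \<in> Cfun T.X" for f g n
    unfolding S_def smooth_add using that by (intro fun_linear_onD(1)[OF \<nu>(1)] smooth_in_Cfun F)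
  have S_scale: "S (\<lambda>x. c * f x) n = c * S f n" if "f \<in> Cfun T.X" for c f n
    unfolding S_def smooth_scale using that by (intro fun_linear_onD(2)[OF \<nu>(1)] smooth_in_Cfun F)
  have S_pull: "S f n = T f n" if "f \<in> ?V" for f n
  proof -
    have "smooth (kk (level n)) (F (level n)) f = f" using that smooth_pull[OF F(2)] by auto
    then show ?thesis using \<nu>(2)[OF that] by (simp add: S_def)
  qed
  have S_chi: "S (chi t) \<longlonglongrightarrow> 0" if t: "t \<in> A" for t
  proof (cases "t \<in> A'")
    case True
    \<comment> \<open>From level \<open>j\<close> on, \<open>t\<close> belongs to
      \<open>F (level n)\<close> and its step is replaced by a pulled-back cut.\<close>
    define j where "j = Suc (to_nat_on A' t)"
    show ?thesis
    proof (rule LIMSEQ_I)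
      fix \<epsilon> :: real assume "\<epsilon> > 0"
      then obtain i where i: "inverse (real (Suc i)) < \<epsilon>" using reals_Archimedean by blast
      have "\<bar>S (chi t) n\<bar> < \<epsilon>" if n: "n \<ge> max (max j (N j)) (max i (N i))" for n
      proof -
        have lv: "j \<le> level n" "i \<le> level n" using level_ge n by auto
        then have tF: "t \<in> F (level n)" using True by (auto simp: F_def j_def)
        then have "smooth (kk (level n)) (F (level n)) (chi t) = pull (cut t (kk (level n)))"
          using smooth_chi[OF F t] by simp
        then have "S (chi t) n = T (pull (cut t (kk (level n)))) n"
          using \<nu>(2)[of "pull (cut t (kk (level n)))"] cut_bump(1)[OF t] by (simp add: S_def)
        then have "\<bar>S (chi t) n\<bar> < inverse (real (Suc (level n)))" using small[OF tF] by simp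
        also have "\<dots> \<le> inverse (real (Suc i))" using lv(2) by (simp add: divide_simps)
        finally show ?thesis using i by simp
      qed
      then show "\<exists>n0. \<forall>n\<ge>n0. norm (S (chi t) n - 0) < \<epsilon>"
        by (intro exI[of _ "max (max j (N j)) (max i (N i))"]) simp
    qed
  next
    case False
    \<comment> \<open>No \<open>\<nu> n\<close> sees this bump, so all of them treat
      \<open>chi t\<close> as the pulled-back function \<open>pull (cut t k)\<close>.\<close>
    then obtain k where k: "\<And>n. \<nu> n (bump t k) = 0" using good t by blast
    have pV: "pull (cut t k) \<in> ?V" using cut_bump(1)[OF t] by blast
    have "S (chi t) n = T (pull (cut t k)) n" for n
    proof -
      have "t \<notin> F (level n)" using False by (simp add: F_def)
      then have "S (chi t) n = \<nu> n (chi t)" using smooth_chi[OF F t] by (simp add: S_def)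
      also have "\<dots> = \<nu> n (\<lambda>P. bump t k P + pull (cut t k) P)" by (simp add: bump_def)
      also have "\<dots> = \<nu> n (bump t k) + \<nu> n (pull (cut t k))"
        using pV pull_subset_Cfun by (intro fun_linear_onD(1)[OF \<nu>(1)] bump_in_Cfun[OF t]) auto
      finally show ?thesis using k \<nu>(2)[OF pV] by simp
    qed
    then have "S (chi t) = T (pull (cut t k))" by (rule ext)
    then show ?thesis using Tlim[OF pV] by simp
  qed
  have S_lim: "S f \<longlonglongrightarrow> 0" if f: "f \<in> Cfun T.X" for f
  proof (rule LIMSEQ_I)
    fix \<epsilon> :: real assume \<epsilon>: "\<epsilon> > 0"
    \<comment> \<open>\<open>3 * M\<close> bounds the extension, so an error \<open>\<delta>\<close>
      costs at most half of \<open>\<epsilon>\<close>; the summand 1 keeps the denominator positive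
      when \<open>M\<close> is 0.\<close>
    define \<delta> where "\<delta> = \<epsilon> / (2 * (3 * M + 1))"
    have \<delta>: "\<delta> > 0" "3 * M * \<delta> \<le> \<epsilon> / 2"
      using \<epsilon> M by (auto simp: \<delta>_def field_simps)
    define D where "D = {d \<in> Cfun T.X. S d \<longlonglongrightarrow> 0}"
    have D1: "?V \<subseteq> D"
    proof
      fix f assume f: "f \<in> ?V"
      have "S f = T f" by (rule ext) (rule S_pull[OF f])
      then show "f \<in> D" using f pull_subset_Cfun Tlim[OF f] unfolding D_def by auto
    qed
    have D2: "chi ` A \<subseteq> D" using S_chi chi_in_Cfun unfolding D_def by blast
    have D3: "(\<lambda>x. d x + e x) \<in> D" if "d \<in> D" "e \<in> D" for d e
    proof -
      have de: "d \<in> Cfun T.X" "e \<in> Cfun T.X" "S d \<longlonglongrightarrow> 0" "S e \<longlonglongrightarrow> 0" using that by (auto simp: D_def)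
      have "S (\<lambda>x. d x + e x) = (\<lambda>n. S d n + S e n)" by (rule ext) (rule S_add[OF de(1,2)])
      then have "S (\<lambda>x. d x + e x) \<longlonglongrightarrow> 0" using tendsto_add[OF de(3,4)] by simp
      then show ?thesis using fun_subspaceD(2)[OF fun_subspace_Cfun de(1,2)] by (simp add: D_def)
    qed
    have D4: "(\<lambda>x. c * d x) \<in> D" if "d \<in> D" for c d
    proof -
      have de: "d \<in> Cfun T.X" "S d \<longlonglongrightarrow> 0" using that by (auto simp: D_def)
      have "S (\<lambda>x. c * d x) = (\<lambda>n. c * S d n)" by (rule ext) (rule S_scale[OF de(1)])
      then have "S (\<lambda>x. c * d x) \<longlonglongrightarrow> 0" using tendsto_mult_left[OF de(2), of c] by simp
      then show ?thesis using fun_subspaceD(3)[OF fun_subspace_Cfun de(1)] by (simp add: D_def)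
    qed
    obtain d where d: "d \<in> D" "\<And>P. P \<in> Kt \<Longrightarrow> \<bar>f P - d P\<bar> \<le> \<delta>"
      by (rule dense_span[OF f \<delta>(1) D1 D2 D3 D4]) (assumption+, rule that)
    have dC: "d \<in> Cfun T.X" and dl: "S d \<longlonglongrightarrow> 0" using d(1) by (auto simp: D_def)
    have fd: "(\<lambda>x. f x - d x) \<in> Cfun T.X" by (rule fun_subspaceD(4)[OF fun_subspace_Cfun f dC])
    have "?n (\<lambda>x. f x - d x) \<le> \<delta>"
      using d(2) by (intro sup_norm_le[OF compact_Kt]) (simp add: T.topspace_order)
    then have "3 * M * ?n (\<lambda>x. f x - d x) \<le> 3 * M * \<delta>" using M by (intro mult_left_mono) auto
    then have close: "\<bar>S (\<lambda>x. f x - d x) n\<bar> \<le> \<epsilon> / 2" for n using S_bound[OF fd, of n] \<delta>(2) by linarith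
    have split: "S f n = S (\<lambda>x. f x - d x) n + S d n" for n
      using S_add[OF fd dC, of n] by simp
    obtain n0 where n0: "\<forall>n\<ge>n0. \<bar>S d n\<bar> < \<epsilon> / 2" using LIMSEQ_D[OF dl, of "\<epsilon> / 2"] \<epsilon> by auto
    have "norm (S f n - 0) < \<epsilon>" if "n \<ge> n0" for n
    proof -
      have "\<bar>S d n\<bar> < \<epsilon> / 2" using n0 that by blast
      then show ?thesis using close[of n] split[of n] by simp
    qed
    then show "\<exists>n0. \<forall>n\<ge>n0. norm (S f n - 0) < \<epsilon>" by blast
  qed
  have "bounded_linear_op_into_c0 T.X (Cfun T.X) UNIV S"
    unfolding bounded_linear_op_into_c0_def
  proof (intro conjI ballI allI)
    fix f assume "f \<in> Cfun T.X"
    then show "S f \<in> c0 UNIV" by (simp add: c0_nat_iff S_lim)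
  next
    fix f g assume "f \<in> Cfun T.X" "g \<in> Cfun T.X"
    then show "S (\<lambda>x. f x + g x) = (\<lambda>i. S f i + S g i)" by (intro ext S_add)
  next
    fix c f assume "f \<in> Cfun T.X"
    then show "S (\<lambda>x. c * f x) = (\<lambda>i. c * S f i)" by (intro ext S_scale)
  next
    have "sup_norm_on UNIV (S f) \<le> 3 * M * ?n f" if "f \<in> Cfun T.X" for f
      unfolding sup_norm_on_def[of UNIV] using S_bound[OF that] by (intro cSUP_least) auto
    then show "\<exists>M. \<forall>f\<in>Cfun T.X. sup_norm_on UNIV (S f) \<le> M * ?n f" by blast
  qed
  moreover have "\<forall>f\<in>?V. S f = T f" using S_pull by blast
  ultimately show "\<exists>S. bounded_linear_op_into_c0 T.X (Cfun T.X) UNIV S \<and> (\<forall>f\<in>?V. S f = T f)" by blast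
qed

end

section \<open>An operator without extension\<close>

context lex_ladder
begin

text \<open>On a cylinder \<open>s\<close> the operator takes the difference of the values at its two ends. Evaluated at
  lower copies it also acts on \<open>chi t\<close>, and there it is 1 for every cylinder around \<open>t\<close>.\<close>

theorem not_c0_extension:
  assumes inj: "inj_on \<iota> {prefix_of t k | t k. t \<in> A}" and img: "\<iota> ` {prefix_of t k | t k. t \<in> A} \<subseteq> I"
  shows "\<not> c0_extension_property T.X X base I"
proof
  assume ep: "c0_extension_property T.X X base I"
  let ?V = "pull ` Cfun X" and ?n = "sup_norm_on (topspace T.X)"
  define S0 where "S0 = {prefix_of t k | t k. t \<in> A}"
  have inj': "inj_on \<iota> S0" and img': "\<iota> ` S0 \<subseteq> I" using inj img by (simp_all add: S0_def)
  define T where "T f i = (if i \<in> \<iota> ` S0 then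
      f (lower (extend (inv_into S0 \<iota> i) hi)) - f (lower (extend (inv_into S0 \<iota> i) lo)) else 0)"
    for f :: "((nat \<Rightarrow> 'a) \<Rightarrow> bool) \<Rightarrow> real" and i
  have T_at: "T f (\<iota> s) = f (lower (extend s hi)) - f (lower (extend s lo))" if "s \<in> S0" for f s
    using that inj' by (simp add: T_def)
  have T_bound: "\<bar>T f i\<bar> \<le> 2 * ?n f" if "f \<in> Cfun T.X" for f i
    using abs_le_sup_norm[OF compact_Kt that, of "lower (extend (inv_into S0 \<iota> i) hi)"]
      abs_le_sup_norm[OF compact_Kt that, of "lower (extend (inv_into S0 \<iota> i) lo)"]
    unfolding T_def by auto
  have T_add: "T (\<lambda>x. f x + g x) i = T f i + T g i"
    and T_scale: "T (\<lambda>x. c * f x) i = c * T f i" for f g c i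
    by (simp_all add: T_def algebra_simps)
  \<comment> \<open>A constant regressive map has an uncountable fibre, so \<open>W0\<close> is
    nonempty; the supremum over \<open>I\<close> is then taken over a nonempty set.\<close>
  obtain \<alpha>0 where "\<alpha>0 \<in> W0" using pressing_down[of "\<lambda>_. []"] by force
  then have "lad \<alpha>0 \<in> A" by (simp add: A_def)
  then have I_ne: "I \<noteq> {}" using img' unfolding S0_def by blast
  have "bounded_linear_op_into_c0 T.X ?V I T"
    unfolding bounded_linear_op_into_c0_def
  proof (intro conjI ballI allI)
    fix f assume "f \<in> ?V"
    then obtain g where g: "g \<in> Cfun X" "f = pull g" by blast
    have "finite {i \<in> I. \<bar>T f i\<bar> \<ge> \<epsilon>}" if "\<epsilon> > 0" for \<epsilon>
    proof (rule finite_subset)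
      show "{i \<in> I. \<bar>T f i\<bar> \<ge> \<epsilon>} \<subseteq> \<iota> ` {s. \<bar>g (extend s hi) - g (extend s lo)\<bar> \<ge> \<epsilon>}"
      proof
        fix i assume i: "i \<in> {i \<in> I. \<bar>T f i\<bar> \<ge> \<epsilon>}"
        then have "i \<in> \<iota> ` S0" using that by (auto simp: T_def split: if_splits)
        then obtain s where "s \<in> S0" "i = \<iota> s" by blast
        then show "i \<in> \<iota> ` {s. \<bar>g (extend s hi) - g (extend s lo)\<bar> \<ge> \<epsilon>}"
          using i T_at[of s f] g(2) by auto
      qed
    qed (rule finite_imageI[OF finite_large_oscillation[OF g(1) that]])
    moreover have "T f i = 0" if "i \<notin> I" for i using that img' by (auto simp: T_def)
    ultimately show "T f \<in> c0 I" unfolding c0_def by blast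
  next
    fix f g show "T (\<lambda>x. f x + g x) = (\<lambda>i. T f i + T g i)" by (rule ext) (rule T_add)
  next
    fix c f show "T (\<lambda>x. c * f x) = (\<lambda>i. c * T f i)" by (rule ext) (rule T_scale)
  next
    have "sup_norm_on I (T f) \<le> 2 * ?n f" if "f \<in> ?V" for f
      unfolding sup_norm_on_def[of I] using that T_bound pull_subset_Cfun I_ne
      by (intro cSUP_least) auto
    then show "\<exists>M. \<forall>f\<in>?V. sup_norm_on I (T f) \<le> M * ?n f" by blast
  qed
  then obtain S where S: "bounded_linear_op_into_c0 T.X (Cfun T.X) I S" "\<And>f. f \<in> ?V \<Longrightarrow> S f = T f"
    using ep unfolding c0_extension_property_def pullback_space_pull by blast
  have S_c0: "S f \<in> c0 I" if "f \<in> Cfun T.X" for f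
    using S(1) that unfolding bounded_linear_op_into_c0_def by (elim conjE) (drule (1) bspec, assumption)
  have S_add: "S (\<lambda>x. f x + g x) i = S f i + S g i" if "f \<in> Cfun T.X" "g \<in> Cfun T.X" for f g i
    using S(1) that unfolding bounded_linear_op_into_c0_def by simp
  have S_scale: "S (\<lambda>x. c * f x) i = c * S f i" if "f \<in> Cfun T.X" for c f i
    using S(1) that unfolding bounded_linear_op_into_c0_def by simp
  have "\<exists>M. \<forall>f\<in>Cfun T.X. sup_norm_on I (S f) \<le> M * ?n f"
    using S(1) unfolding bounded_linear_op_into_c0_def by (elim conjE)
  then obtain M where M: "\<And>f. f \<in> Cfun T.X \<Longrightarrow> sup_norm_on I (S f) \<le> M * ?n f" by blast
  \<comment> \<open>\<open>R i\<close> vanishes on pullbacks, so its value at \<open>chi t\<close>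
    is its value at every bump of \<open>t\<close>, however small the cylinder.\<close>
  define R where "R i f = T f i - S f i" for i f
  have R_lin: "fun_linear_on (Cfun T.X) (R i)" for i
    unfolding fun_linear_on_def R_def by (simp add: T_add T_scale S_add S_scale algebra_simps)
  have R_pull: "R i f = 0" if "f \<in> ?V" for i f using S(2)[OF that] by (simp add: R_def)
  have R_bump: "R i (chi t) = R i (bump t k)" if t: "t \<in> A" for i t k
  proof -
    have "chi t = (\<lambda>P. bump t k P + pull (cut t k) P)" by (simp add: bump_def)
    then have "R i (chi t) = R i (bump t k) + R i (pull (cut t k))"
      using fun_linear_onD(1)[OF R_lin bump_in_Cfun[OF t] pull_in_Cfun[OF cut_bump(1)[OF t]]] by metis
    then show ?thesis using R_pull cut_bump(1)[OF t] by simp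
  qed
  \<comment> \<open>The prefixes of one ladder give infinitely many coordinates. On these
    \<open>S\<close> must tend to 0 at the step, whereas \<open>T\<close> is always 1.\<close>
  have "\<exists>k. R (\<iota> (prefix_of (lad \<alpha>) k)) (chi (lad \<alpha>)) \<ge> 1/2" if \<alpha>: "\<alpha> \<in> W0" for \<alpha>
  proof -
    let ?t = "lad \<alpha>"
    have t: "?t \<in> A" using \<alpha> by (simp add: A_def)
    let ?i = "\<lambda>k. \<iota> (prefix_of ?t k)"
    have sS: "prefix_of ?t k \<in> S0" for k unfolding S0_def using t by blast
    have "inj ?i"
    proof (rule injI)
      fix k l assume "?i k = ?i l"
      then have "prefix_of ?t k = prefix_of ?t l" using inj_onD[OF inj' _ sS sS] by blast
      then show "k = l" by (metis length_prefix_of)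
    qed
    moreover have fin: "finite {i \<in> I. \<bar>S (chi ?t) i\<bar> \<ge> \<epsilon>}" if "\<epsilon> > 0" for \<epsilon>
      using S_c0[OF chi_in_Cfun[OF t]] that unfolding c0_def by blast
    have "finite {i \<in> I. \<bar>S (chi ?t) i\<bar> \<ge> 1/2}" by (rule fin) simp
    ultimately have "finite (?i -` {i \<in> I. \<bar>S (chi ?t) i\<bar> \<ge> 1/2})"
      by (intro finite_vimageI)
    then obtain k where "k \<notin> ?i -` {i \<in> I. \<bar>S (chi ?t) i\<bar> \<ge> 1/2}"
      using ex_new_if_finite infinite_UNIV_nat by blast
    then have k: "\<bar>S (chi ?t) (?i k)\<bar> < 1/2" using sS img' by auto
    \<comment> \<open>The left end may be \<open>t\<close> itself, but its lower copy still lies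
      before the gap; the right end lies strictly after it.\<close>
    have "?t \<sqsubset> extend (prefix_of ?t k) hi" using lt_extend_hi A_neq_hi[OF t] by blast
    moreover have "\<not> ?t \<sqsubset> extend (prefix_of ?t k) lo" using prefix_cylinder(1)[of ?t k] le_antisym by blast
    ultimately have "T (chi ?t) (?i k) = 1" using T_at[OF sS] by simp
    then show ?thesis using k unfolding R_def by (intro exI[of _ k]) linarith
  qed
  then have "\<forall>\<alpha>. \<exists>k. \<alpha> \<in> W0 \<longrightarrow> R (\<iota> (prefix_of (lad \<alpha>) k)) (chi (lad \<alpha>)) \<ge> 1/2" by blast
  from choice[OF this] obtain kk where
    kk: "\<And>\<alpha>. \<alpha> \<in> W0 \<Longrightarrow> R (\<iota> (prefix_of (lad \<alpha>) (kk \<alpha>))) (chi (lad \<alpha>)) \<ge> 1/2" by blast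
  have "\<exists>s. uncountable {\<alpha> \<in> W0. prefix_of (lad \<alpha>) (kk \<alpha>) = s}"
  proof (rule pressing_down)
    show "set (prefix_of (lad \<alpha>) (kk \<alpha>)) \<subseteq> below \<alpha>" if "\<alpha> \<in> W0" for \<alpha>
      using set_prefix_of[of "lad \<alpha>" "kk \<alpha>"] range_lad'[OF that] by simp
  qed
  then obtain s where s: "uncountable {\<alpha> \<in> W0. prefix_of (lad \<alpha>) (kk \<alpha>) = s}" by blast
  define Z where "Z = lad ` {\<alpha> \<in> W0. prefix_of (lad \<alpha>) (kk \<alpha>) = s}"
  have "Z \<subseteq> A" unfolding Z_def A_def by blast
  moreover have "R (\<iota> s) (chi t) \<ge> 1/2" if "t \<in> Z" for t
    using that kk unfolding Z_def by blast
  ultimately have Z: "Z \<subseteq> A" "\<And>t. t \<in> Z \<Longrightarrow> R (\<iota> s) (chi t) \<ge> 1/2" by blast+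
  have "inj_on lad {\<alpha> \<in> W0. prefix_of (lad \<alpha>) (kk \<alpha>) = s}"
    by (rule inj_on_subset[OF inj_lad]) blast
  then have "infinite Z"
    using s countable_finite finite_imageD unfolding Z_def by blast
  have "{\<alpha> \<in> W0. prefix_of (lad \<alpha>) (kk \<alpha>) = s} \<noteq> {}"
  proof
    assume empty: "{\<alpha> \<in> W0. prefix_of (lad \<alpha>) (kk \<alpha>) = s} = {}"
    show False using s unfolding empty by simp
  qed
  then have sI: "\<iota> s \<in> I" using img' unfolding S0_def A_def by blast
  \<comment> \<open>2 bounds \<open>T\<close> and the absolute value of \<open>M\<close> bounds
    \<open>S\<close>, so \<open>q\<close> disjoint bumps contributing at least 1/2 each exceed the
    bound for \<open>R\<close>.\<close>
  obtain q where q: "2 * (2 + \<bar>M\<bar>) < real q" using reals_Archimedean2 by blast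
  obtain F where F: "F \<subseteq> Z" "finite F" "card F = q"
    using infinite_arbitrarily_large[OF \<open>infinite Z\<close>] by metis
  obtain k where k: "inj_on (\<lambda>x. prefix_of x k) F" by (rule prefix_of_inj_on[OF F(2)]) (rule that)
  have FA: "F \<subseteq> A" using F(1) Z(1) by blast
  define g where "g = (\<lambda>P. \<Sum>t\<in>F. bump t k P)"
  have g: "g \<in> Cfun T.X"
    unfolding g_def using FA by (intro fun_subspace_sum fun_subspace_Cfun F(2) bump_in_Cfun) blast
  have "\<bar>g P\<bar> \<le> 1" for P
    using abs_sum_bump_le[OF F(2) FA k, of 1 "\<lambda>_. 1" P] by (simp add: g_def)
  then have gn: "?n g \<le> 1" by (intro sup_norm_le[OF compact_Kt])
  have "\<bar>S g (\<iota> s)\<bar> \<le> M * ?n g"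
    using c0_abs_le_sup_norm[OF S_c0[OF g] sI] M[OF g] by linarith
  also have "\<dots> \<le> \<bar>M\<bar> * ?n g"
    using sup_norm_nonneg[OF compact_Kt g] by (intro mult_right_mono) auto
  also have "\<dots> \<le> \<bar>M\<bar>" using mult_left_mono[OF gn, of "\<bar>M\<bar>"] by simp
  finally have "R (\<iota> s) g \<le> 2 + \<bar>M\<bar>"
    using T_bound[OF g, of "\<iota> s"] gn unfolding R_def by linarith
  moreover have "R (\<iota> s) g = (\<Sum>t\<in>F. R (\<iota> s) (bump t k))"
    unfolding g_def using FA F(2) bump_in_Cfun by (intro fun_linear_on_sum[OF R_lin fun_subspace_Cfun]) auto
  moreover have "(\<Sum>t\<in>F. R (\<iota> s) (bump t k)) \<ge> (\<Sum>t\<in>F. 1/2)"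
  proof (rule sum_mono)
    fix t assume "t \<in> F"
    then have "t \<in> Z" "t \<in> A" using F(1) FA by blast+
    then show "1/2 \<le> R (\<iota> s) (bump t k)" using Z(2)[OF \<open>t \<in> Z\<close>] R_bump[OF \<open>t \<in> A\<close>, of "\<iota> s" k] by linarith
  qed
  ultimately have "real q / 2 \<le> 2 + \<bar>M\<bar>" using F(3) by simp
  then show False using q by (simp add: field_simps)
qed

end

section \<open>The main theorem\<close>

text \<open>The successor cardinal of the natural numbers embeds into \<open>X\<close>, and its
  well-order is transported along the embedding. Its proper initial segments have smaller
  cardinality, hence are countable.\<close>

lemma uncountable_subset_aleph1:
  assumes "uncountable X"
  obtains W :: "'a set" and below where "W \<subseteq> X" "uncountable W" "ordIso2 (card_of W) (cardSuc natLeq)"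
    "\<And>\<alpha>. \<alpha> \<in> W \<Longrightarrow> below \<alpha> \<subseteq> W" "\<And>\<alpha>. \<alpha> \<in> W \<Longrightarrow> countable (below \<alpha>)"
    "\<And>Z. Z \<subseteq> W \<Longrightarrow> Z \<noteq> {} \<Longrightarrow> \<exists>m\<in>Z. below m \<inter> Z = {}" "\<And>\<alpha>. \<alpha> \<notin> below \<alpha>"
    "\<And>\<alpha> \<beta>. \<alpha> \<in> W \<Longrightarrow> \<beta> \<in> W \<Longrightarrow> \<alpha> \<noteq> \<beta> \<Longrightarrow> \<alpha> \<in> below \<beta> \<or> \<beta> \<in> below \<alpha>"
proof -
  let ?r = "cardSuc natLeq"
  have r: "Card_order ?r" by (rule cardSuc_Card_order[OF natLeq_Card_order])
  have wo: "Well_order ?r" using r unfolding card_order_on_def by blast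
  have "\<not> ordLeq3 (card_of X) natLeq" using assms by (simp add: countable_card_le_natLeq)
  then have "ordLess2 natLeq (card_of X)"
    using not_ordLeq_iff_ordLess[OF natLeq_Well_order card_of_Well_order] by blast
  then have rX: "ordLeq3 ?r (card_of X)"
    using cardSuc_ordLess_ordLeq[OF natLeq_Card_order card_of_Card_order] by blast
  have Fr: "ordIso2 (card_of (Field ?r)) ?r" by (rule card_of_Field_ordIso[OF r])
  have "ordLeq3 (card_of (Field ?r)) (card_of X)" by (rule ordIso_ordLeq_trans[OF Fr rX])
  then obtain g where g: "inj_on g (Field ?r)" "g ` Field ?r \<subseteq> X"
    unfolding card_of_ordLeq[symmetric] by blast
  define W where "W = g ` Field ?r"
  define below where "below \<alpha> = {g b | a b. a \<in> Field ?r \<and> \<alpha> = g a \<and> b \<in> underS ?r a}" for \<alpha>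
  have below_g: "below (g a) = g ` underS ?r a" if "a \<in> Field ?r" for a
  proof -
    have "a' = a" if "a' \<in> Field ?r" "g a = g a'" for a'
      using inj_onD[OF g(1)] that \<open>a \<in> Field ?r\<close> by metis
    then show ?thesis using that unfolding below_def by auto
  qed
  have under_F: "underS ?r a \<subseteq> Field ?r" for a by (auto simp: underS_def Field_def)
  have "bij_betw g (Field ?r) W" using g(1) by (simp add: W_def bij_betw_def)
  then have "ordIso2 (card_of (Field ?r)) (card_of W)" using card_of_ordIso by blast
  then have card_W: "ordIso2 (card_of W) ?r" using ordIso_transitive[OF ordIso_symmetric Fr] by blast
  show ?thesis
  proof (rule that[of W below])
    show "W \<subseteq> X" using g by (simp add: W_def)
    show "ordIso2 (card_of W) ?r" by (rule card_W)
    show "uncountable W"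
    proof
      assume "countable W"
      then have "ordLeq3 (card_of W) natLeq" by (simp add: countable_card_le_natLeq)
      then have "ordLeq3 ?r natLeq" using ordIso_ordLeq_trans[OF ordIso_symmetric[OF card_W]] by blast
      then show False using cardSuc_greater[OF natLeq_Card_order] not_ordLess_ordLeq by blast
    qed
    show "below \<alpha> \<subseteq> W" if "\<alpha> \<in> W" for \<alpha>
      using that below_g under_F unfolding W_def by blast
    show "countable (below \<alpha>)" if \<alpha>: "\<alpha> \<in> W" for \<alpha>
    proof -
      obtain a where a: "a \<in> Field ?r" "\<alpha> = g a" using \<alpha> unfolding W_def by blast
      have "ordLess2 (card_of (underS ?r a)) ?r" by (rule card_of_underS[OF r a(1)])
      then have "ordLeq3 (card_of (underS ?r a)) natLeq"
        using cardSuc_ordLeq_ordLess[OF natLeq_Card_order card_of_Card_order] by blast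
      then have "countable (underS ?r a)" by (simp add: countable_card_le_natLeq)
      then show ?thesis using below_g[OF a(1)] a(2) by simp
    qed
    show "\<exists>m\<in>Z. below m \<inter> Z = {}" if Z: "Z \<subseteq> W" "Z \<noteq> {}" for Z
    proof -
      define Y where "Y = {a \<in> Field ?r. g a \<in> Z}"
      have "Y \<noteq> {}" using Z unfolding Y_def W_def by blast
      moreover have "wf (?r - Id)" using wo unfolding well_order_on_def by blast
      ultimately obtain m where m: "m \<in> Y" "\<And>y. (y, m) \<in> ?r - Id \<Longrightarrow> y \<notin> Y"
        using wfE_min[of "?r - Id"] by (metis ex_in_conv)
      have "below (g m) \<inter> Z = {}"
      proof -
        have "g b \<notin> Z" if "b \<in> underS ?r m" for b
        proof -
          have "b \<in> Field ?r" using that under_F by blast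
          moreover have "(b, m) \<in> ?r - Id" using that unfolding underS_def by blast
          ultimately show ?thesis using m(2) unfolding Y_def by blast
        qed
        moreover have "below (g m) = g ` underS ?r m" using below_g m(1) unfolding Y_def by blast
        ultimately show ?thesis by auto
      qed
      then show ?thesis using m(1) unfolding Y_def by blast
    qed
    show "\<alpha> \<notin> below \<alpha>" for \<alpha>
    proof
      assume "\<alpha> \<in> below \<alpha>"
      then obtain a b where ab: "a \<in> Field ?r" "\<alpha> = g a" "\<alpha> = g b" "b \<in> underS ?r a"
        unfolding below_def by blast
      then have "b \<in> Field ?r" "g a = g b" using under_F by auto
      then have "a = b" using inj_onD[OF g(1)] ab(1) by blast
      then show False using ab(4) unfolding underS_def by blast
    qed
    show "\<alpha> \<in> below \<beta> \<or> \<beta> \<in> below \<alpha>" if ab: "\<alpha> \<in> W" "\<beta> \<in> W" "\<alpha> \<noteq> \<beta>" for \<alpha> \<beta>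
    proof -
      obtain a b where *: "a \<in> Field ?r" "\<alpha> = g a" "b \<in> Field ?r" "\<beta> = g b"
        using ab unfolding W_def by blast
      then have "a \<noteq> b" using ab(3) by blast
      then have "(a, b) \<in> ?r \<or> (b, a) \<in> ?r"
        using wo * unfolding well_order_on_def linear_order_on_def total_on_def by blast
      then have "a \<in> underS ?r b \<or> b \<in> underS ?r a" using \<open>a \<noteq> b\<close> unfolding underS_def by blast
      then show ?thesis using below_g * by blast
    qed
  qed
qed

text \<open>The index sets of size omega_1 are taken among sets of reals. They exist because the
  continuum is uncountable, so the last clause is not vacuous.\<close>

theorem theorem4p7:
  assumes "compact (UNIV :: 'a::linorder_topology set)"
      and "uncountable (UNIV :: 'a set)"
  shows "\<exists>(Kt :: ((nat \<Rightarrow> 'a) \<Rightarrow> bool) set) rt (\<phi> :: ((nat \<Rightarrow> 'a) \<Rightarrow> bool) \<Rightarrow> (nat \<Rightarrow> 'a)).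
           compact_line Kt rt \<and>
           continuous_map (order_topology_on Kt rt) (order_topology_on UNIV lex_omega) \<phi> \<and>
           \<phi> ` Kt = UNIV \<and>
           (\<forall>x\<in>Kt. \<forall>y\<in>Kt. (x, y) \<in> rt \<longrightarrow> (\<phi> x, \<phi> y) \<in> lex_omega) \<and>
           c0_extension_property (order_topology_on Kt rt) (order_topology_on UNIV lex_omega) \<phi>
             (UNIV :: nat set) \<and>
           (\<forall>I :: real set. ordIso2 (card_of I) (cardSuc natLeq) \<longrightarrow>
              \<not> c0_extension_property (order_topology_on Kt rt) (order_topology_on UNIV lex_omega) \<phi> I)"
proof -
  note lub = compact_UNIV_lub[OF assms(1)]
  obtain lo :: 'a where lo: "\<And>x. lo \<le> x" using lub[of "{}"] by auto
  obtain hi :: 'a where hi: "\<And>x. x \<le> hi" using lub[of UNIV] by auto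
  have "uncountable (UNIV - {hi})" using assms(2) by (simp add: uncountable_minus_countable)
  then obtain W :: "'a set" and below where W: "W \<subseteq> UNIV - {hi}" "uncountable W"
    "ordIso2 (card_of W) (cardSuc natLeq)"
    "\<And>\<alpha>. \<alpha> \<in> W \<Longrightarrow> below \<alpha> \<subseteq> W" "\<And>\<alpha>. \<alpha> \<in> W \<Longrightarrow> countable (below \<alpha>)"
    "\<And>Z. Z \<subseteq> W \<Longrightarrow> Z \<noteq> {} \<Longrightarrow> \<exists>m\<in>Z. below m \<inter> Z = {}" "\<And>\<alpha>. \<alpha> \<notin> below \<alpha>"
    "\<And>\<alpha> \<beta>. \<alpha> \<in> W \<Longrightarrow> \<beta> \<in> W \<Longrightarrow> \<alpha> \<noteq> \<beta> \<Longrightarrow> \<alpha> \<in> below \<beta> \<or> \<beta> \<in> below \<alpha>"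
    by (rule uncountable_subset_aleph1) (rule that)
  \<comment> \<open>Entries repeat when \<open>below \<alpha>\<close> is finite, so the range is all
    of \<open>below \<alpha>\<close> in that case too.\<close>
  define lad where "lad \<alpha> = from_nat_into (below \<alpha>)" for \<alpha>
  interpret complete_line "UNIV :: (nat \<Rightarrow> 'a) set" lex_omega
    by (rule complete_line_lex_omega[OF lub])
  interpret lex_ladder lo hi W below lad
  proof unfold_locales
    show "hi \<notin> W" using W(1) by blast
    show "range (lad \<alpha>) = below \<alpha>" if "\<alpha> \<in> W" "below \<alpha> \<noteq> {}" for \<alpha>
      unfolding lad_def by (rule range_from_nat_into[OF that(2) W(5)[OF that(1)]])
  qed (fact lo hi W)+
  have neg: "\<not> c0_extension_property T.X X base I" if I: "ordIso2 (card_of I) (cardSuc natLeq)" for I :: "real set"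
  proof -
    have infW: "\<not> finite W" using W(2) countable_finite by blast
    have natW: "ordLeq3 (card_of (UNIV :: nat set)) (card_of W)"
      using infW infinite_iff_card_of_nat by blast
    \<comment> \<open>A prefix is determined by the index of a ladder and a length, so there are no
      more prefixes than elements of \<open>W\<close>, and they can be coded injectively in
      \<open>I\<close>.\<close>
    have "{prefix_of t k | t k. t \<in> A} \<subseteq> (\<lambda>(\<alpha>, k). prefix_of (lad \<alpha>) k) ` (W \<times> UNIV)"
      unfolding A_def W0_def by auto
    then have "ordLeq3 (card_of {prefix_of t k | t k. t \<in> A}) (card_of (W \<times> (UNIV :: nat set)))"
      by (rule ordLeq_transitive[OF card_of_mono1 card_of_image])
    also have "ordIso2 (card_of (W \<times> (UNIV :: nat set))) (card_of W)"
      using card_of_Times_infinite[OF infW _ natW] by blast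
    also have "ordIso2 (card_of W) (card_of I)"
      by (rule ordIso_transitive[OF W(3) ordIso_symmetric[OF I]])
    finally obtain \<iota> where "inj_on \<iota> {prefix_of t k | t k. t \<in> A}" "\<iota> ` {prefix_of t k | t k. t \<in> A} \<subseteq> I"
      unfolding card_of_ordLeq[symmetric] by blast
    then show ?thesis by (rule not_c0_extension)
  qed
  have "compact_line Kt rt"
    unfolding compact_line_def using T.line T.compact_space_order by blast
  moreover have "\<forall>x\<in>Kt. \<forall>y\<in>Kt. (x, y) \<in> rt \<longrightarrow> (base x, base y) \<in> lex_omega"
    using base_mono by blast
  ultimately show ?thesis
    using continuous_base base_surj c0_extension_nat neg by blast
qed

end
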